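(* Consider the immersed weak Galerkin method: find $u_h=\{u_{h0},u_{hb}\}\in V_h$ with $u_{hb}=Q_b g$ on every edge contained in $\partial\Omega$ such that $$A(u_h,v)=(f,v_0)\qquad\text{for all } v=\{v_0,v_b\}\in V_h^0,$$ where $$A(w,v)=\sum_{T\in\mathcal{T}_h}\Big((\beta\nabla w_0,\nabla v_0)_T-\langle Q_b(\beta\nabla w_0\cdot\mathbf{n}),v_0-v_b\rangle_{\partial T}-\langle Q_b(\beta\nabla v_0\cdot\mathbf{n}),w_0-w_b\rangle_{\partial T}+\rho h^{-1}\langle Q_bw_0-w_b,Q_bv_0-v_b\rangle_{\partial T}\Big).$$ If the constant $\rho>0$ is large enough, then this problem has a unique solution.
   Context: Setting. $\Omega\subset\mathbb{R}^2$ is a bounded domain separated by an interface curve $\Gamma$ into two subdomains $\Omega^+$ and $\Omega^-$. The coefficient $\beta$ equals a positive constant $\beta^-$ in $\Omega^-$ and a positive constant $\beta^+$ in $\Omega^+$. The data $f$ (source) and $g$ (Dirichlet boundary data) come from the interface problem $-\nabla\cdot(\beta\nabla u)=f$ in $\Omega^-\cup\Omega^+$, $u=g$ on $\partial\Omega$, with jump conditions $[u]_\Gamma=0$ and $[\beta\nabla u\cdot\mathbf{n}]_\Gamma=0$, where $[v]_\Gamma=v^+|_\Gamma-v^-|_\Gamma$ and $\mathbf n$ in the jump condition is the unit normal to $\Gamma$. Mesh. $\mathcal{T}_h$ is a shape-regular triangular mesh of $\Omega$, not necessarily aligned with $\Gamma$; $h_T$ is the diameter of $T$, $h=\max_T h_T$.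 Elements cut by $\Gamma$ are called interface elements (set $\mathcal{T}_h^I$), the others regular elements (set $\mathcal{T}_h^R$). $\mathcal{E}_h$ is the set of all edges. It is assumed that for $h$ small enough: $\Gamma$ cannot intersect an edge of any element at more than two points unless the edge is part of $\Gamma$; if $\Gamma$ intersects the boundary of an element at two points, these lie on different edges of the element; $\Gamma$ is piecewise $C^2$ and its portion in every interface element is $C^2$; the number of interface elements is $O(h^{-1})$. Immersed finite element (IFE) space. On an interface element $T$ with vertices $A_1,A_2,A_3$, let $\Gamma$ meet $\partial T$ at $D,E$; the segment $\overline{DE}$ divides $T$ into $T^+$ and $T^-$ (corresponding to $\Omega^+$ and $\Omega^-$). The IFE shape functions $\phi_i$, $i=1,2,3$, are the functions that are affine on each of $T^+$ and $T^-$, and satisfy $\phi_i(A_j)=\delta_{ij}$, have zero jump at $D$ and $E$, and have $[\beta\,\partial\phi_i/\partial n]=0$ across $\overline{DE}$ ($\beta=\beta^\pm$ on $T^\pm$, $n$ normal to $\overline{DE}$); these conditions determine them uniquely. $\tilde P_1(T)=\mathrm{span}\{\phi_1,\phi_2,\phi_3\}$. Weak functions. $V_h$ is the set of pairs $v=\{v_0,v_b\}$ with $v_0|_T\in P_1(T)$ (polynomials of degree at most 1) if $T\in\mathcal{T}_h^R$, $v_0|_T\in\tilde P_1(T)$ if $T\in\mathcal{T}_h^I$ (no continuity between elements), and $v_b|_e\in P_0(e)$ (a constant) for every $e\in\mathcal{E}_h$. $V_h^0=\{v\in V_h: v_b=0\text{ on }\partial\Omega\}$. $Q_b$ is the $L^2(e)$-projection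 onto constants on every edge $e$. $(\cdot,\cdot)_T$ and $\langle\cdot,\cdot\rangle_{\partial T}$ are the $L^2$ inner products on $T$ and $\partial T$, $(\cdot,\cdot)$ is the one on $\Omega$; in boundary terms on $\partial T$, $\mathbf{n}$ is the outward unit normal of $T$ and $v_0$ is the trace from $T$. *)

theory Defs
  imports "HOL-Analysis.Analysis"
begin

section \<open>The interface problem\<close>

type_synonym plane = "real^2"

record interface_problem =
  Omega :: "plane set"
  Omega_p :: "plane set"
  Omega_m :: "plane set"
  curve :: "real \<Rightarrow> plane"
  beta_p :: real
  beta_m :: real

abbreviation interface :: "interface_problem \<Rightarrow> plane set" where
  "interface P \<equiv> path_image (curve P)"

text \<open>A \<open>C\<^sup>2\<close> parametrization of a \<open>C\<^sup>2\<close> curve has to be regular, i.e. have nonvanishing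
  velocity.  Derivatives at the end points of \<^term>\<open>S\<close> are one-sided.\<close>

definition regular_C2_on :: "real set \<Rightarrow> (real \<Rightarrow> plane) \<Rightarrow> bool" where
  "regular_C2_on S c \<longleftrightarrow>
     (\<exists>c' c''. (\<forall>t\<in>S. (c has_vector_derivative c' t) (at t within S) \<and> c' t \<noteq> 0 \<and>
                     (c' has_vector_derivative c'' t) (at t within S)) \<and>
              continuous_on S c'')"

definition piecewise_regular_C2 :: "(real \<Rightarrow> plane) \<Rightarrow> bool" where
  "piecewise_regular_C2 c \<longleftrightarrow>
     (\<exists>K. finite K \<and> {0, 1} \<subseteq> K \<and> K \<subseteq> {0..1} \<and>
          (\<forall>a\<in>K. \<forall>b\<in>K. a < b \<and> {a<..<b} \<inter> K = {} \<longrightarrow> regular_C2_on {a..b} c))"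

text \<open>The curve may be closed (an inclusion) or end on the boundary of the domain.  The
  inclusion in the two frontiers says that the curve really is the interface between the two
  subdomains (no piece of it has the same subdomain on both sides).\<close>

definition interface_setting :: "interface_problem \<Rightarrow> bool" where
  "interface_setting P \<longleftrightarrow>
     open (Omega P) \<and> connected (Omega P) \<and> bounded (Omega P) \<and>
     open (Omega_p P) \<and> connected (Omega_p P) \<and> Omega_p P \<noteq> {} \<and>
     open (Omega_m P) \<and> connected (Omega_m P) \<and> Omega_m P \<noteq> {} \<and>
     Omega_p P \<inter> Omega_m P = {} \<and>
     simple_path (curve P) \<and> piecewise_regular_C2 (curve P) \<and>
     interface P \<subseteq> closure (Omega P) \<and>
     Omega P - interface P = Omega_p P \<union> Omega_m P \<and>
     Omega P \<inter> interface P \<subseteq> frontier (Omega_p P) \<inter> frontier (Omega_m P) \<and>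
     0 < beta_p P \<and> 0 < beta_m P"

text \<open>The value on the interface itself is immaterial.\<close>

definition beta :: "interface_problem \<Rightarrow> plane \<Rightarrow> real" where
  "beta P x = (if x \<in> Omega_m P then beta_m P else beta_p P)"

section \<open>Meshes\<close>

definition tri_edges :: "plane set \<Rightarrow> plane set set" where
  "tri_edges T = {e. e edge_of T}"

definition tri_vertices :: "plane set \<Rightarrow> plane set" where
  "tri_vertices T = {A. A extreme_point_of T}"

definition mesh_edges :: "plane set set \<Rightarrow> plane set set" where
  "mesh_edges \<T> = (\<Union>T\<in>\<T>. tri_edges T)"

definition boundary_edges :: "interface_problem \<Rightarrow> plane set set \<Rightarrow> plane set set" where
  "boundary_edges P \<T> = {e \<in> mesh_edges \<T>. e \<subseteq> frontier (Omega P)}"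

definition mesh_size :: "plane set set \<Rightarrow> real" where
  "mesh_size \<T> = Max (diameter ` \<T>)"

definition shape_regular :: "real \<Rightarrow> plane set set \<Rightarrow> bool" where
  "shape_regular \<kappa> \<T> \<longleftrightarrow>
     (\<forall>T\<in>\<T>. \<exists>x r. 0 < r \<and> cball x r \<subseteq> T \<and> diameter T \<le> \<kappa> * (2 * r))"

text \<open>\<^const>\<open>triangulation\<close> makes the mesh finite and conforming (no hanging nodes).
  The last condition says that the mesh resolves the boundary of the domain.\<close>

definition triangular_mesh :: "interface_problem \<Rightarrow> plane set set \<Rightarrow> bool" where
  "triangular_mesh P \<T> \<longleftrightarrow>
     triangulation \<T> \<and> (\<forall>T\<in>\<T>. 2 simplex T) \<and>
     \<Union>\<T> = closure (Omega P) \<and>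
     \<Union>(boundary_edges P \<T>) = frontier (Omega P)"

definition interface_elements :: "interface_problem \<Rightarrow> plane set set \<Rightarrow> plane set set" where
  "interface_elements P \<T> = {T \<in> \<T>. interior T \<inter> interface P \<noteq> {}}"

text \<open>In an interface element the interface is a \<open>C\<^sup>2\<close> arc that joins two boundary points
  \<^term>\<open>D\<close>, \<^term>\<open>E\<close> and has no other point in common with the boundary; \<^term>\<open>D\<close> and
  \<^term>\<open>E\<close> have no edge in common, for otherwise the segment between them would not divide
  the element.\<close>

definition interface_resolved :: "interface_problem \<Rightarrow> plane set set \<Rightarrow> bool" where
  "interface_resolved P \<T> \<longleftrightarrow>
     (\<forall>e\<in>mesh_edges \<T>. e \<subseteq> interface P \<or>
         finite (e \<inter> interface P) \<and> card (e \<inter> interface P) \<le> 2) \<and>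
     (\<forall>T\<in>\<T>. \<forall>D E. D \<noteq> E \<and> interface P \<inter> frontier T = {D, E} \<longrightarrow>
         (\<exists>d\<in>tri_edges T. \<exists>e\<in>tri_edges T. d \<noteq> e \<and> D \<in> d \<and> E \<in> e)) \<and>
     (\<forall>T\<in>interface_elements P \<T>. \<exists>D E c. D \<noteq> E \<and>
         interface P \<inter> frontier T = {D, E} \<and>
         (\<forall>e\<in>tri_edges T. \<not> {D, E} \<subseteq> e) \<and>
         arc c \<and> regular_C2_on {0..1} c \<and> pathstart c = D \<and> pathfinish c = E \<and>
         path_image c = interface P \<inter> T)"

definition admissible_mesh ::
    "interface_problem \<Rightarrow> real \<Rightarrow> real \<Rightarrow> plane set set \<Rightarrow> bool" where
  "admissible_mesh P \<kappa> C \<T> \<longleftrightarrow>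
     triangular_mesh P \<T> \<and> shape_regular \<kappa> \<T> \<and> interface_resolved P \<T> \<and>
     real (card (interface_elements P \<T>)) \<le> C / mesh_size \<T>"

section \<open>Local spaces\<close>

text \<open>Functions on an element are represented by functions on the plane that vanish outside
  of the (closed) element, so that equality is equality on the element.\<close>

definition P1 :: "plane set \<Rightarrow> (plane \<Rightarrow> real) set" where
  "P1 T = {w. (\<exists>a G. \<forall>x\<in>T. w x = a + G \<bullet> x) \<and> (\<forall>x. x \<notin> T \<longrightarrow> w x = 0)}"

text \<open>The closed part of \<^term>\<open>T\<close>, cut along the segment \<open>DE\<close>, that corresponds to the
  subdomain \<^term>\<open>S\<close>: it is the convex hull of that one of the two arcs of the boundary of
  \<^term>\<open>T\<close> between \<open>D\<close> and \<open>E\<close> along which \<^term>\<open>T\<close> lies in \<^term>\<open>S\<close>.\<close>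

definition cut_part :: "plane set \<Rightarrow> plane set \<Rightarrow> plane set" where
  "cut_part S T = convex hull (frontier T \<inter> closure (interior T \<inter> S))"

definition ife_shape ::
    "interface_problem \<Rightarrow> plane set \<Rightarrow> plane \<Rightarrow> (plane \<Rightarrow> real) \<Rightarrow> bool" where
  "ife_shape P T A \<phi> \<longleftrightarrow>
     (\<forall>x. x \<notin> T \<longrightarrow> \<phi> x = 0) \<and>
     (\<forall>B\<in>tri_vertices T. \<phi> B = (if B = A then 1 else 0)) \<and>
     (\<exists>ap Gp am Gm D E.
        interface P \<inter> frontier T = {D, E} \<and> D \<noteq> E \<and>
        (\<forall>x\<in>cut_part (Omega_p P) T. \<phi> x = ap + Gp \<bullet> x) \<and>
        (\<forall>x\<in>cut_part (Omega_m P) T. \<phi> x = am + Gm \<bullet> x) \<and>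
        ap + Gp \<bullet> D = am + Gm \<bullet> D \<and> ap + Gp \<bullet> E = am + Gm \<bullet> E \<and>
        (\<forall>n. n \<bullet> (E - D) = 0 \<longrightarrow> beta_p P * (Gp \<bullet> n) = beta_m P * (Gm \<bullet> n)))"

text \<open>The span of the shape functions (finite linear combinations).\<close>

definition IFE :: "interface_problem \<Rightarrow> plane set \<Rightarrow> (plane \<Rightarrow> real) set" where
  "IFE P T = {w. \<exists>F c. finite F \<and> F \<subseteq> {\<phi>. \<exists>A\<in>tri_vertices T. ife_shape P T A \<phi>} \<and>
                      w = (\<lambda>x. \<Sum>\<phi>\<in>F. c \<phi> * \<phi> x)}"

section \<open>Weak functions\<close>

text \<open>The interior component has one function for each element, the boundary component one
  constant for each edge.  Both are extended by zero to non-elements and non-edges.\<close>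

type_synonym weak_fun = "(plane set \<Rightarrow> plane \<Rightarrow> real) \<times> (plane set \<Rightarrow> real)"

definition Vh :: "interface_problem \<Rightarrow> plane set set \<Rightarrow> weak_fun set" where
  "Vh P \<T> = {(v0, vb).
     (\<forall>T\<in>interface_elements P \<T>. v0 T \<in> IFE P T) \<and>
     (\<forall>T\<in>\<T> - interface_elements P \<T>. v0 T \<in> P1 T) \<and>
     (\<forall>T. T \<notin> \<T> \<longrightarrow> v0 T = (\<lambda>x. 0)) \<and>
     (\<forall>e. e \<notin> mesh_edges \<T> \<longrightarrow> vb e = 0)}"

definition Vh0 :: "interface_problem \<Rightarrow> plane set set \<Rightarrow> weak_fun set" where
  "Vh0 P \<T> = {v \<in> Vh P \<T>. \<forall>e\<in>boundary_edges P \<T>. snd v e = 0}"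

section \<open>Edge integrals, projection, traces\<close>

text \<open>Integral over a segment with respect to arc length.  It does not depend on the
  order of the end points.\<close>

definition edge_integral :: "plane set \<Rightarrow> (plane \<Rightarrow> real) \<Rightarrow> real" where
  "edge_integral e F = (THE I. \<forall>a b. e = closed_segment a b \<longrightarrow>
     I = dist a b * (LINT t:{0..1}|lebesgue. F (linepath a b t)))"

definition L2_edge :: "plane set \<Rightarrow> (plane \<Rightarrow> real) \<Rightarrow> bool" where
  "L2_edge e F \<longleftrightarrow> (\<forall>a b. e = closed_segment a b \<longrightarrow>
     set_borel_measurable lebesgue {0..1} (\<lambda>t. F (linepath a b t)) \<and>
     set_integrable lebesgue {0..1} (\<lambda>t. (F (linepath a b t))\<^sup>2))"

definition L2_on :: "plane set \<Rightarrow> (plane \<Rightarrow> real) \<Rightarrow> bool" where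
  "L2_on S F \<longleftrightarrow> set_borel_measurable lebesgue S F \<and> set_integrable lebesgue S (\<lambda>x. (F x)\<^sup>2)"

definition Qb :: "plane set \<Rightarrow> (plane \<Rightarrow> real) \<Rightarrow> real" where
  "Qb e F = (THE c. \<forall>q. edge_integral e (\<lambda>x. (F x - c) * q) = 0)"

definition grad :: "(plane \<Rightarrow> real) \<Rightarrow> plane \<Rightarrow> plane" where
  "grad w x = (THE G. GDERIV w x :> G)"

definition outer_normal :: "plane set \<Rightarrow> plane set \<Rightarrow> plane" where
  "outer_normal T e = (THE n. norm n = 1 \<and> (\<forall>x\<in>e. \<forall>y\<in>T. n \<bullet> (y - x) \<le> 0))"

text \<open>Trace from \<^term>\<open>T\<close> of the normal flux on the edge \<^term>\<open>e\<close>.  Taking the limit from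
  inside matters for the coefficient if the edge is part of the interface.\<close>

definition flux :: "interface_problem \<Rightarrow> plane set \<Rightarrow> plane set \<Rightarrow> (plane \<Rightarrow> real) \<Rightarrow> plane \<Rightarrow> real"
  where "flux P T e w x =
     Lim (at x within interior T) (\<lambda>y. beta P y * (grad w y \<bullet> outer_normal T e))"

section \<open>The immersed weak Galerkin method\<close>

definition iwg_form ::
    "interface_problem \<Rightarrow> plane set set \<Rightarrow> real \<Rightarrow> weak_fun \<Rightarrow> weak_fun \<Rightarrow> real" where
  "iwg_form P \<T> \<rho> w v =
     (case (w, v) of ((w0, wb), (v0, vb)) \<Rightarrow>
       (\<Sum>T\<in>\<T>.
          (LINT x:T|lebesgue. beta P x * (grad (w0 T) x \<bullet> grad (v0 T) x))
          - (\<Sum>e\<in>tri_edges T. edge_integral e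
               (\<lambda>x. Qb e (flux P T e (w0 T)) * (v0 T x - vb e)))
          - (\<Sum>e\<in>tri_edges T. edge_integral e
               (\<lambda>x. Qb e (flux P T e (v0 T)) * (w0 T x - wb e)))
          + \<rho> * inverse (mesh_size \<T>) * (\<Sum>e\<in>tri_edges T. edge_integral e
               (\<lambda>x. (Qb e (w0 T) - wb e) * (Qb e (v0 T) - vb e)))))"

text \<open>The inner product with \<^term>\<open>f\<close> over the domain, whose closure is the union of the
  elements, which overlap in null sets only.\<close>

definition iwg_load :: "plane set set \<Rightarrow> (plane \<Rightarrow> real) \<Rightarrow> weak_fun \<Rightarrow> real" where
  "iwg_load \<T> f v = (\<Sum>T\<in>\<T>. LINT x:T|lebesgue. f x * fst v T x)"

definition iwg_solution :: "interface_problem \<Rightarrow> plane set set \<Rightarrow> real \<Rightarrow>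
    (plane \<Rightarrow> real) \<Rightarrow> (plane \<Rightarrow> real) \<Rightarrow> weak_fun \<Rightarrow> bool" where
  "iwg_solution P \<T> \<rho> f g u \<longleftrightarrow>
     u \<in> Vh P \<T> \<and>
     (\<forall>e\<in>boundary_edges P \<T>. snd u e = Qb e g) \<and>
     (\<forall>v\<in>Vh0 P \<T>. iwg_form P \<T> \<rho> u v = iwg_load \<T> f v)"

end

theory Submission
  imports Defs
begin

text \<open>The space of weak functions is finite-dimensional, so the problem is uniquely solvable as soon as the
form \<open>A\<close> is definite on \<^term>\<open>Vh0 P \<T>\<close> (\<open>galerkin_solvable\<close>).  The penalty makes it definite if
two terms can be balanced on every single element: the flux means \<open>Q\<^sub>b (\<beta> \<nabla>v\<^sub>0 \<bullet> n)\<close> have to be bounded by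
the energy norm of \<open>\<nabla>v\<^sub>0\<close> on that element, with a constant that does not depend on how the interface cuts
the element.

This holds for the following reason.  On a cut element a local function is
\<open>a + G \<bullet> x + \<mu> (G \<bullet> n) max 0 (n \<bullet> x - d)\<close> with the unit normal \<open>n\<close> of the chord between the two points where
the interface crosses the boundary: continuity at these points makes the jump of the gradient normal to the
chord, and the flux condition then determines it, with \<open>\<mu> = \<beta>\<^sup>-/\<beta>\<^sup>+ - 1 > -1\<close>.  Affine functions
have the same form with a line beyond the element.  So one vector \<open>G\<close> controls the
gradients on both parts from above and from below, and even if one of the parts is tiny the energy is
at least a constant times the area of the element times \<open>\<bar>G\<bar>\<^sup>2\<close> (\<open>energy_coercive\<close>), while the flux means are
at most a constant times \<open>\<bar>G\<bar>\<close> (\<open>mean_flux\<close>).  Shape regularity and quasi-uniformity bound the area from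
below by a multiple of \<open>h\<^sup>2\<close>, and Young's inequality gives coercivity (\<open>element_form_coercive\<close>).  The
coefficient in the energy jumps across the curve whereas the local functions have their kink on the chord, so
the energy is estimated with the bounds of the coefficient only.

If the form vanishes, then \<open>v\<^sub>0\<close> is constant on every element and equal to \<open>v\<^sub>b\<close> on its edges, so the constants
of neighbouring elements agree.  A nonzero constant would reach an edge on the boundary of the domain
(\<open>marked_elements_reach_boundary\<close>), where \<open>v\<^sub>b\<close> vanishes.

What is left is the representation of local functions on the whole element.  Since the parts of a cut element
are convex hulls of boundary arcs, this requires that along the boundary of the element the two
subdomains are separated by the line through the two crossing points (\<open>interface_element_cut\<close>).  The
reason is that an arc does not separate the plane.\<close>

section \<open>Variational problems in finite dimension\<close>

text \<open>Finite dimension is expressed by finitely many linear functionals \<open>K\<close> that separate the points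
of \<open>V\<close> up to negligible ones, so
that \<open>V\<close> need not live in a vector space type; \<open>comb u t v\<close> stands for \<open>u + t v\<close>.  The induction removes one
functional \<open>k\<close>: on its kernel the problem is solvable, and \<open>y\<close>, which is orthogonal to the kernel, corrects the
solution in the one direction that is missing.  Vectors with \<open>B v v = 0\<close> are required to be negligible for
\<open>B\<close> and \<open>F\<close> instead of zero, because this property passes to subspaces without any reference to a zero element.\<close>

lemma galerkin_solvable:
  fixes comb :: "'v \<Rightarrow> real \<Rightarrow> 'v \<Rightarrow> 'v" and B :: "'v \<Rightarrow> 'v \<Rightarrow> real"
    and K :: "('v \<Rightarrow> real) set"
  assumes "finite K" and "V \<noteq> {}"
    and "\<And>u t v. u \<in> V \<Longrightarrow> v \<in> V \<Longrightarrow> comb u t v \<in> V"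
    and "\<And>u t v w. u \<in> V \<Longrightarrow> v \<in> V \<Longrightarrow> w \<in> V \<Longrightarrow> B (comb u t v) w = B u w + t * B v w"
    and "\<And>u t v w. u \<in> V \<Longrightarrow> v \<in> V \<Longrightarrow> w \<in> V \<Longrightarrow> B w (comb u t v) = B w u + t * B w v"
    and "\<And>u t v. u \<in> V \<Longrightarrow> v \<in> V \<Longrightarrow> F (comb u t v) = F u + t * F v"
    and "\<And>k u t v. k \<in> K \<Longrightarrow> u \<in> V \<Longrightarrow> v \<in> V \<Longrightarrow> k (comb u t v) = k u + t * k v"
    and "\<And>v. v \<in> V \<Longrightarrow> B v v = 0 \<Longrightarrow> (\<forall>w\<in>V. B w v = 0) \<and> F v = 0"
    and "\<And>v. v \<in> V \<Longrightarrow> \<forall>k\<in>K. k v = 0 \<Longrightarrow> (\<forall>w\<in>V. B w v = 0) \<and> F v = 0"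
  shows "\<exists>u\<in>V. \<forall>v\<in>V. B u v = F v"
  using assms
proof (induction K arbitrary: V F rule: finite_induct)
  case empty
  then show ?case by (metis all_not_in_conv empty_iff)
next
  case (insert k K V F)
  note closed = insert.prems(2) and B1 = insert.prems(3) and B2 = insert.prems(4)
    and F1 = insert.prems(5) and K1 = insert.prems(6) and dfn = insert.prems(7)
    and sep = insert.prems(8)
  have k1: "k (comb u t v) = k u + t * k v" if "u \<in> V" "v \<in> V" for u t v
    using K1[of k] that by simp
  define Z where "Z = {v \<in> V. k v = 0}"
  have ZV: "Z \<subseteq> V" by (auto simp: Z_def)
  obtain v0 where v0: "v0 \<in> V" using insert.prems(1) by auto
  have Zne: "Z \<noteq> {}"
    using closed[OF v0 v0, of "-1"] k1[OF v0 v0, of "-1"] by (auto simp: Z_def)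
  have Zsolve: "\<exists>u\<in>Z. \<forall>v\<in>Z. B u v = H v"
    if H1: "\<And>u t v. u \<in> V \<Longrightarrow> v \<in> V \<Longrightarrow> H (comb u t v) = H u + t * H v"
      and H2: "\<And>v. v \<in> V \<Longrightarrow> (\<forall>w\<in>V. B w v = 0) \<and> F v = 0 \<Longrightarrow> H v = 0" for H
  proof (rule insert.IH)
    show "comb u t v \<in> Z" if "u \<in> Z" "v \<in> Z" for u t v
      using that closed k1 by (auto simp: Z_def)
    show "(\<forall>w\<in>Z. B w v = 0) \<and> H v = 0" if "v \<in> Z" "B v v = 0" for v
      using that ZV dfn[of v] H2[of v] by blast
    show "(\<forall>w\<in>Z. B w v = 0) \<and> H v = 0" if "v \<in> Z" "\<forall>k\<in>K. k v = 0" for v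
    proof -
      have "v \<in> V" "\<forall>k\<in>insert k K. k v = 0" using that by (auto simp: Z_def)
      then show ?thesis using sep[of v] H2[of v] ZV by blast
    qed
    show "kk (comb u t v) = kk u + t * kk v" if "kk \<in> K" "u \<in> Z" "v \<in> Z" for kk u t v
      using K1[of kk u v t] that ZV by auto
  qed (use Zne B1 B2 H1 ZV[THEN subsetD] in auto)
  show ?case
  proof (cases "\<forall>v\<in>V. k v = 0")
    case True
    then have "Z = V" by (auto simp: Z_def)
    then show ?thesis using Zsolve[of F] F1 by simp
  next
    case False
    then obtain z where z: "z \<in> V" "k z \<noteq> 0" by auto
    obtain p where p: "p \<in> Z" "\<And>v. v \<in> Z \<Longrightarrow> B p v = B z v"
      using Zsolve[of "B z"] B2 z(1) by auto
    obtain u0 where u0: "u0 \<in> Z" "\<And>v. v \<in> Z \<Longrightarrow> B u0 v = F v"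
      using Zsolve[of F] F1 by auto
    define y where "y = comb z (-1) p"
    have pV: "p \<in> V" and u0V: "u0 \<in> V" using p u0 ZV by auto
    have y: "y \<in> V" unfolding y_def by (rule closed[OF z(1) pV])
    have ky: "k y \<noteq> 0" using k1[OF z(1) pV, of "-1"] p(1) z(2) by (auto simp: y_def Z_def)
    have By: "B y v = 0" if "v \<in> Z" for v
      using B1[OF z(1) pV, of v "-1"] p(2)[OF that] that ZV by (auto simp: y_def)
    \<comment> \<open>if \<open>B y y = 0\<close>, then \<open>y\<close> is negligible and any \<open>s\<close> would do\<close>
    define s where "s = (if B y y = 0 then 0 else (F y - B u0 y) / B y y)"
    define u where "u = comb u0 s y"
    have uV: "u \<in> V" unfolding u_def by (rule closed[OF u0V y])
    have Bu: "B u w = B u0 w + s * B y w" if "w \<in> V" for w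
      unfolding u_def by (rule B1[OF u0V y that])
    have Buy: "B u y = F y"
    proof (cases "B y y = 0")
      case True
      then show ?thesis using dfn[OF y True] u0V Bu[OF y] by (simp add: s_def)
    next
      case False
      then show ?thesis using Bu[OF y] by (simp add: s_def)
    qed
    have "B u v = F v" if v: "v \<in> V" for v
    proof -
      define r where "r = - k v / k y"
      have "comb v r y \<in> Z"
        using closed[OF v y] k1[OF v y] ky by (auto simp: Z_def r_def)
      then have "B u (comb v r y) = F (comb v r y)"
        using Bu[of "comb v r y"] u0(2) By ZV by auto
      then show ?thesis
        using B2[OF v y uV, of r] F1[OF v y, of r] Buy by simp
    qed
    then show ?thesis using uV by blast
  qed
qed

section \<open>Triangles\<close>

lemma triangle_vertices:
  fixes T :: "plane set"
  assumes "2 simplex T"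
  obtains S where "finite S" "card S = 3" "\<not> affine_dependent S" "T = convex hull S"
  using assms by (auto simp: simplex)

lemma triangle_basic:
  fixes T :: "plane set"
  assumes "2 simplex T"
  shows "compact T" "convex T" "aff_dim T = 2" "interior T \<noteq> {}" "rel_interior T = interior T"
    "closure (interior T) = T" "polyhedron T" "rel_frontier T = frontier T"
proof -
  show c: "compact T" and cv: "convex T"
    using assms by (auto simp: simplex compact_convex_hull finite_imp_compact)
  show d: "aff_dim T = 2" using assms aff_dim_simplex by blast
  then have ah: "affine hull T = UNIV" by (simp add: aff_dim_eq_full[symmetric])
  show ri: "rel_interior T = interior T" using ah by (rule rel_interior_interior)
  have "T \<noteq> {}" using d by auto
  then show ne: "interior T \<noteq> {}" using ri cv rel_interior_eq_empty by metis
  show "closure (interior T) = T"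
    using convex_closure_interior[OF cv ne] c by (simp add: compact_imp_closed)
  show "polyhedron T" using assms by (auto simp: simplex intro: polytope_imp_polyhedron polytope_convex_hull)
  show "rel_frontier T = frontier T" by (simp add: rel_frontier_def frontier_def ri)
qed

lemma triangle_frontier:
  assumes "2 simplex T"
  shows "frontier T = \<Union> (tri_edges T)"
proof -
  have "{F. F facet_of T} = tri_edges T"
    by (auto simp: tri_edges_def facet_of_def edge_of_def triangle_basic(3)[OF assms])
  then show ?thesis
    using rel_frontier_of_polyhedron[OF triangle_basic(7)[OF assms]] triangle_basic(8)[OF assms]
    by simp
qed

lemma tri_edges_convex_hull:
  fixes S :: "plane set"
  assumes S: "finite S" "\<not> affine_dependent S" and T: "T = convex hull S"
  shows "tri_edges T = {closed_segment v w |v w. v \<in> S \<and> w \<in> S \<and> v \<noteq> w}"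
proof (intro set_eqI iffI)
  fix e assume "e \<in> tri_edges T"
  then obtain c where c: "c \<subseteq> S" "e = convex hull c" and d: "aff_dim e = 1"
    using face_of_convex_hull_affine_independent[OF S(2)] T
    by (auto simp: tri_edges_def edge_of_def)
  have "\<not> affine_dependent c" using S(2) c(1) affine_dependent_subset by blast
  then have "int (card c) - 1 = 1"
    using d aff_dim_affine_independent[of c] unfolding c(2) aff_dim_convex_hull by simp
  then have "card c = 2" by simp
  then obtain v w where "c = {v,w}" "v \<noteq> w" by (meson card_2_iff)
  then show "e \<in> {closed_segment v w |v w. v \<in> S \<and> w \<in> S \<and> v \<noteq> w}"
    using c by (auto simp: segment_convex_hull)
next
  fix e assume "e \<in> {closed_segment v w |v w. v \<in> S \<and> w \<in> S \<and> v \<noteq> w}"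
  then obtain v w where vw: "v \<in> S" "w \<in> S" "v \<noteq> w" "e = convex hull {v,w}"
    by (auto simp: segment_convex_hull)
  have "aff_dim e = 1" using vw aff_dim_convex_hull[of "{v,w}"] by (simp add: aff_dim_2)
  moreover have "e face_of T"
    unfolding T face_of_convex_hull_affine_independent[OF S(2)] using vw
    by (intro exI[of _ "{v,w}"]) auto
  ultimately show "e \<in> tri_edges T" by (simp add: tri_edges_def edge_of_def)
qed

lemma tri_edge_segment:
  assumes "2 simplex T" "e \<in> tri_edges T"
  obtains a b where "a \<noteq> b" "e = closed_segment a b" "e \<subseteq> frontier T" "e \<subseteq> T"
proof -
  obtain S where S: "finite S" "card S = 3" "\<not> affine_dependent S" "T = convex hull S"
    using triangle_vertices[OF assms(1)] by blast
  obtain a b where "a \<noteq> b" "e = closed_segment a b"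
    using assms(2) tri_edges_convex_hull[OF S(1,3,4)] by blast
  moreover have "e \<subseteq> frontier T" using assms triangle_frontier by blast
  moreover have "e \<subseteq> T" using assms(2) face_of_imp_subset by (auto simp: tri_edges_def edge_of_def)
  ultimately show ?thesis using that by blast
qed

text \<open>The crude bound counts the subsets of the set of vertices.\<close>

lemma card_tri_edges:
  assumes "2 simplex T"
  shows "finite (tri_edges T)" "card (tri_edges T) \<le> 8"
proof -
  obtain S where S: "finite S" "card S = 3" "\<not> affine_dependent S" "T = convex hull S"
    using triangle_vertices[OF assms] by blast
  have sub: "tri_edges T \<subseteq> (\<lambda>c. convex hull c) ` Pow S"
    using face_of_convex_hull_affine_independent[OF S(3)] S(4)
    by (auto simp: tri_edges_def edge_of_def)
  show "finite (tri_edges T)" using sub S(1) by (simp add: finite_subset)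
  have "card (tri_edges T) \<le> card (Pow S)"
    using sub S(1) by (intro surj_card_le) auto
  also have "card (Pow S) = 8" using S by (simp add: card_Pow)
  finally show "card (tri_edges T) \<le> 8" .
qed

text \<open>A boundary point inside the segment would lie on an edge, and a face that contains an inner point of a
segment contains its end points.\<close>

lemma open_segment_interior_triangle:
  assumes T: "2 simplex T" and DE: "D \<in> T" "E \<in> T" "D \<noteq> E"
    and no: "\<forall>e\<in>tri_edges T. \<not> {D, E} \<subseteq> e"
  shows "open_segment D E \<subseteq> interior T"
proof
  fix x assume x: "x \<in> open_segment D E"
  have xT: "x \<in> T"
    using x DE triangle_basic(2)[OF T] convex_contains_open_segment by blast
  show "x \<in> interior T"
  proof (rule ccontr)
    assume "x \<notin> interior T"
    then have "x \<in> frontier T" using xT by (simp add: frontier_def closure_def)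
    then obtain e where e: "e \<in> tri_edges T" "x \<in> e" using triangle_frontier[OF T] by auto
    then have "e face_of T" by (auto simp: tri_edges_def edge_of_def)
    then have "D \<in> e" "E \<in> e" using face_ofD[of e T x D E] x e DE by auto
    then show False using no e by auto
  qed
qed

lemma collinear_orthogonal:
  fixes u v m :: plane
  assumes "m \<noteq> 0" "u \<bullet> m = 0" "v \<bullet> m = 0" "norm u = 1"
  shows "v = (v \<bullet> u) *\<^sub>R u"
proof -
  have u: "u$1 * m$1 + u$2 * m$2 = 0" and v: "v$1 * m$1 + v$2 * m$2 = 0"
    using assms by (auto simp: inner_vec_def sum_2)
  have n: "u$1 * u$1 + u$2 * u$2 = 1"
    using assms(4) by (simp add: norm_eq_1 inner_vec_def sum_2)
  have m: "m$1 \<noteq> 0 \<or> m$2 \<noteq> 0" using assms(1) by (auto simp: vec_eq_iff forall_2)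
  have det: "u$1 * v$2 = u$2 * v$1"
  proof -
    have "m$1 * (u$1 * v$2 - u$2 * v$1) = 0" "m$2 * (u$1 * v$2 - u$2 * v$1) = 0"
      using u v by algebra+
    then show ?thesis using m by auto
  qed
  have "v$1 = (v$1 * u$1 + v$2 * u$2) * u$1" "v$2 = (v$1 * u$1 + v$2 * u$2) * u$2"
    using det n by algebra+
  then show ?thesis by (simp add: vec_eq_iff forall_2 inner_vec_def sum_2)
qed

text \<open>The description of the outer normal determines a unique vector: a supporting line at the midpoint of the edge
contains the edge, which gives existence; only two unit vectors are orthogonal to the edge, and the
triangle would be flat if both of them pointed outwards.\<close>

lemma norm_outer_normal:
  assumes T: "2 simplex T" and e: "e \<in> tri_edges T"
  shows "norm (outer_normal T e) = 1"
proof -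
  obtain a b where ab: "a \<noteq> b" "e = closed_segment a b" "e \<subseteq> frontier T" "e \<subseteq> T"
    using tri_edge_segment[OF T e] by blast
  define Q where "Q n \<longleftrightarrow> norm n = 1 \<and> (\<forall>x\<in>e. \<forall>y\<in>T. n \<bullet> (y - x) \<le> 0)" for n
  define x where "x = midpoint a b"
  have "x \<in> e" using ab by (simp add: x_def)
  then have "x \<in> T" "x \<notin> rel_interior T"
    using ab triangle_basic(5)[OF T] by (auto simp: frontier_def)
  then obtain m where m: "m \<noteq> 0" "\<And>y. y \<in> T \<Longrightarrow> m \<bullet> x \<le> m \<bullet> y"
    using supporting_hyperplane_rel_boundary[OF triangle_basic(2)[OF T]] by metis
  have abT: "a \<in> T" "b \<in> T" using ab by auto
  have mx: "m \<bullet> x = (m \<bullet> a + m \<bullet> b) / 2"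
    by (simp add: x_def midpoint_def inner_right_distrib)
  then have mab: "m \<bullet> a = m \<bullet> x \<and> m \<bullet> b = m \<bullet> x"
    using m(2)[OF abT(1)] m(2)[OF abT(2)] by argo
  have me: "m \<bullet> z = m \<bullet> x" if z: "z \<in> e" for z
  proof -
    obtain u where "z = (1 - u) *\<^sub>R a + u *\<^sub>R b" using z ab(2) by (auto simp: in_segment)
    then have "m \<bullet> z = (1 - u) * (m \<bullet> x) + u * (m \<bullet> x)" by (simp add: inner_right_distrib mab)
    then show ?thesis by (simp add: algebra_simps)
  qed
  define n where "n = - (1 / norm m) *\<^sub>R m"
  have Qn: "Q n"
    unfolding Q_def n_def using m me by (auto simp: inner_diff_right intro!: divide_right_mono)
  have orth: "w \<bullet> (b - a) = 0" if "Q w" for w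
  proof -
    have "w \<bullet> (b - a) \<le> 0" "w \<bullet> (a - b) \<le> 0" using that ab abT by (auto simp: Q_def)
    then show ?thesis by (simp add: inner_diff_right)
  qed
  have uniq: "w = n" if w: "Q w" for w
  proof -
    have w1: "w = (w \<bullet> n) *\<^sub>R n"
      using collinear_orthogonal[of "b - a" n w] orth[OF w] orth[OF Qn] Qn ab(1)
      by (auto simp: Q_def)
    have abs: "\<bar>w \<bullet> n\<bar> = 1"
      using w Qn arg_cong[OF w1, of norm] by (simp add: Q_def)
    have "w \<bullet> n \<noteq> -1"
    proof
      assume "w \<bullet> n = -1"
      then have wn: "w = - n" using w1 by simp
      have "n \<bullet> y = n \<bullet> x" if "y \<in> T" for y
        using w Qn \<open>x \<in> e\<close> that by (force simp: Q_def wn inner_diff_right)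
      then have "T \<subseteq> {y. n \<bullet> y = n \<bullet> x}" by auto
      moreover have "n \<noteq> 0" using Qn by (auto simp: Q_def)
      ultimately have "interior T = {}"
        using interior_mono interior_hyperplane by blast
      then show False using triangle_basic(4)[OF T] by simp
    qed
    then show ?thesis using abs w1 by (auto simp: abs_if split: if_splits)
  qed
  have "\<exists>!n. Q n" using Qn uniq by metis
  then have "Q (THE n. Q n)" by (rule theI')
  then show ?thesis by (simp add: outer_normal_def Q_def)
qed

section \<open>Cutting a triangle by the interface\<close>

lemma ball_meets_closure:
  fixes x :: "'a::metric_space"
  assumes "x \<in> closure S" "\<epsilon> > 0"
  shows "ball x \<epsilon> \<inter> S \<noteq> {}"
proof -
  obtain y where "y \<in> S" "dist y x < \<epsilon>" using assms closure_approachable by blast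
  then show ?thesis by (auto simp: dist_commute)
qed

text \<open>A linear functional is maximal on an edge at one of its end points, so every point of the boundary on this side
is joined along its edge to a vertex on this side; any two vertices are joined by an edge.\<close>

lemma side_path_connected:
  fixes n :: plane
  assumes T: "2 simplex T"
  shows "path_connected (frontier T \<inter> {x. n \<bullet> x > d})"
proof -
  define C where "C = frontier T \<inter> {x. n \<bullet> x > d}"
  obtain S where S: "finite S" "card S = 3" "\<not> affine_dependent S" "T = convex hull S"
    using triangle_vertices[OF T] by blast
  note edges = tri_edges_convex_hull[OF S(1,3,4)]
  have half: "closed_segment x y \<subseteq> {x. n \<bullet> x > d}" if "n \<bullet> x > d" "n \<bullet> y > d" for x y
    using that by (intro closed_segment_subset) (auto simp: convex_halfspace_gt)
  have comp: "path_component C x y" if "closed_segment x y \<subseteq> C" for x y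
    unfolding path_component_def using that
    by (intro exI[of _ "linepath x y"]) auto
  have vv: "path_component C v w" if vw: "v \<in> S \<inter> C" "w \<in> S \<inter> C" for v w
  proof (cases "v = w")
    case True
    then show ?thesis using vw by (simp add: path_component_refl)
  next
    case False
    then have "closed_segment v w \<in> tri_edges T" using vw edges by blast
    then have "closed_segment v w \<subseteq> frontier T" using triangle_frontier[OF T] by auto
    then show ?thesis using half[of v w] vw by (intro comp) (auto simp: C_def)
  qed
  have xv: "\<exists>v\<in>S \<inter> C. path_component C x v" if x: "x \<in> C" for x
  proof -
    obtain e0 where e0: "e0 \<in> tri_edges T" "x \<in> e0"
      using x triangle_frontier[OF T] by (auto simp: C_def)
    then obtain v w where vw: "v \<in> S" "w \<in> S" "v \<noteq> w" "e0 = closed_segment v w"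
      unfolding edges by auto
    have "e0 \<subseteq> frontier T" using e0(1) triangle_frontier[OF T] by auto
    then have e: "v \<in> S" "w \<in> S" "v \<noteq> w" "x \<in> closed_segment v w" "closed_segment v w \<subseteq> frontier T"
      using vw e0 by auto
    have "\<exists>u\<in>{v,w}. n \<bullet> u > d"
    proof (rule ccontr)
      assume "\<not> ?thesis"
      then have "closed_segment v w \<subseteq> {x. n \<bullet> x \<le> d}"
        by (intro closed_segment_subset) (auto simp: convex_halfspace_le)
      then show False using e x by (auto simp: C_def)
    qed
    then obtain u where u: "u \<in> {v,w}" "n \<bullet> u > d" by auto
    have "closed_segment x u \<subseteq> closed_segment v w"
      using u e by (intro closed_segment_subset) auto
    moreover have "closed_segment x u \<subseteq> {x. n \<bullet> x > d}"
      using half u x by (auto simp: C_def)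
    ultimately have sub: "closed_segment x u \<subseteq> C" using e by (auto simp: C_def)
    have "u \<in> S \<inter> C" using u e sub by auto
    then show ?thesis using comp[OF sub] by blast
  qed
  have "path_component C x y" if "x \<in> C" "y \<in> C" for x y
    using xv[OF that(1)] xv[OF that(2)] vv
    by (meson path_component_sym path_component_trans)
  then show ?thesis unfolding C_def[symmetric] path_connected_component by blast
qed

text \<open>Near a boundary point off the interface, the interior of a convex set looks like a convex set
  that avoids the interface, so it lies in one of the subdomains; which one cannot change along a
  connected part of the boundary.\<close>

lemma one_sided_along_connected:
  fixes T :: "plane set"
  assumes T: "convex T" "closure (interior T) = T" and AB: "open A" "open B" "A \<inter> B = {}"
    and J: "closed J" "interior T - J \<subseteq> A \<union> B"
    and C: "connected C" "C \<subseteq> frontier T" "C \<inter> J = {}"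
  shows "(\<forall>x\<in>C. \<exists>\<epsilon>>0. ball x \<epsilon> \<inter> interior T \<subseteq> A) \<or>
         (\<forall>x\<in>C. \<exists>\<epsilon>>0. ball x \<epsilon> \<inter> interior T \<subseteq> B)"
proof -
  define N where "N X = {x. \<exists>\<epsilon>>0. ball x \<epsilon> \<inter> interior T \<subseteq> X}" for X
  have open_N: "open (N X)" for X
  proof (rule openI)
    fix x assume "x \<in> N X"
    then obtain \<epsilon> where \<epsilon>: "\<epsilon> > 0" "ball x \<epsilon> \<inter> interior T \<subseteq> X" by (auto simp: N_def)
    have "y \<in> N X" if "y \<in> ball x (\<epsilon>/2)" for y
    proof -
      have "ball y (\<epsilon>/2) \<subseteq> ball x \<epsilon>"
      proof
        fix z assume "z \<in> ball y (\<epsilon>/2)"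
        then show "z \<in> ball x \<epsilon>" using that dist_triangle[of x z y] by simp
      qed
      then show ?thesis using \<epsilon> by (auto simp: N_def intro!: exI[of _ "\<epsilon>/2"])
    qed
    then show "\<exists>e>0. ball x e \<subseteq> N X" using \<epsilon>(1) by (intro exI[of _ "\<epsilon>/2"]) auto
  qed
  have cT: "C \<subseteq> closure (interior T)" using C(2) T(2) by (metis frontier_def Diff_subset closure_closure subset_trans)
  have meets: "ball x \<epsilon> \<inter> interior T \<noteq> {}" if "x \<in> C" "\<epsilon> > 0" for x \<epsilon>
    using cT that ball_meets_closure by blast
  have "C \<inter> N A \<inter> N B = {}"
  proof -
    have False if x: "x \<in> C" "x \<in> N A" "x \<in> N B" for x
    proof -
      obtain a b where ab: "a > 0" "ball x a \<inter> interior T \<subseteq> A" "b > 0" "ball x b \<inter> interior T \<subseteq> B"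
        using x(2,3) by (auto simp: N_def)
      have "ball x (min a b) \<inter> interior T \<subseteq> A \<inter> B" using ab by auto
      then show False using meets[OF x(1), of "min a b"] ab AB(3) by auto
    qed
    then show ?thesis by auto
  qed
  moreover have "C \<subseteq> N A \<union> N B"
  proof
    fix x assume x: "x \<in> C"
    have "open (- J)" "x \<in> - J" using J(1) C(3) x by auto
    then obtain \<epsilon> where \<epsilon>: "\<epsilon> > 0" "ball x \<epsilon> \<subseteq> - J" using open_contains_ball by blast
    define W where "W = ball x \<epsilon> \<inter> interior T"
    have "connected W" unfolding W_def
      by (intro convex_connected convex_Int convex_interior T convex_ball)
    moreover have "W \<subseteq> A \<union> B" using J(2) \<epsilon> by (auto simp: W_def)
    ultimately have "A \<inter> W = {} \<or> B \<inter> W = {}"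
      using AB connectedD[of W A B] by auto
    then have "W \<subseteq> A \<or> W \<subseteq> B" using \<open>W \<subseteq> A \<union> B\<close> by auto
    then show "x \<in> N A \<union> N B" using \<epsilon>(1) by (auto simp: N_def W_def)
  qed
  ultimately have "N A \<inter> C = {} \<or> N B \<inter> C = {}"
    using connectedD[OF C(1) open_N[of A] open_N[of B]] by auto
  then have "C \<subseteq> N A \<or> C \<subseteq> N B" using \<open>C \<subseteq> N A \<union> N B\<close> by auto
  then show ?thesis by (auto simp: N_def)
qed

text \<open>An arc does not separate the plane.  If the boundary of the element, apart from the end points
  of the arc, had \<open>A\<close> on its inner side everywhere, then the part of the element in \<open>B\<close> would be
  bounded, open, and closed in the complement of the arc.\<close>

lemma arc_cut_two_sides:
  fixes T :: "plane set" and c :: "real \<Rightarrow> plane"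
  assumes T: "bounded T" "closed T" and AB: "open A" "open B" "A \<inter> B = {}"
    and c: "arc c" "interior T - path_image c \<subseteq> A \<union> B" "path_image c \<inter> frontier T = {D, E}"
    and side: "\<And>x. x \<in> frontier T - {D, E} \<Longrightarrow> \<exists>\<epsilon>>0. ball x \<epsilon> \<inter> interior T \<subseteq> A"
    and disj: "B \<inter> path_image c = {}"
  shows "interior T \<inter> B = {}"
proof (rule ccontr)
  define U where "U = interior T \<inter> B"
  assume "interior T \<inter> B \<noteq> {}"
  then have ne: "U \<noteq> {}" by (simp add: U_def)
  have opU: "open U" using AB by (auto simp: U_def)
  have clU: "closure U \<subseteq> U \<union> path_image c"
  proof
    fix z assume z: "z \<in> closure U"
    have "closure U \<subseteq> T" using T(2) interior_subset
      by (metis U_def closure_minimal inf.coboundedI1)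
    then have zT: "z \<in> T" using z by auto
    have meet: "ball z \<epsilon> \<inter> U \<noteq> {}" if "\<epsilon> > 0" for \<epsilon>
      using z that ball_meets_closure by blast
    have notA: "z \<notin> A"
    proof
      assume "z \<in> A"
      then obtain \<epsilon> where "\<epsilon> > 0" "ball z \<epsilon> \<subseteq> A" using AB(1) open_contains_ball by blast
      then show False using meet[of \<epsilon>] AB(3) by (auto simp: U_def)
    qed
    show "z \<in> U \<union> path_image c"
    proof (cases "z \<in> interior T")
      case True
      then show ?thesis using notA c(2) by (auto simp: U_def)
    next
      case False
      then have zf: "z \<in> frontier T" using zT closure_subset by (auto simp: frontier_def)
      have "z \<in> {D, E}"
      proof (rule ccontr)
        assume "z \<notin> {D, E}"
        then obtain \<epsilon> where "\<epsilon> > 0" "ball z \<epsilon> \<inter> interior T \<subseteq> A" using side zf by blast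
        then show False using meet[of \<epsilon>] AB(3) by (auto simp: U_def)
      qed
      then show ?thesis using c(3) by auto
    qed
  qed
  have conn: "connected (- path_image c)"
    using connected_arc_complement[OF c(1)] by simp
  have sub: "U \<subseteq> - path_image c" using disj by (auto simp: U_def)
  have "- path_image c \<subseteq> U \<union> - closure U" using clU by auto
  then have "U \<inter> - path_image c = {} \<or> - closure U \<inter> - path_image c = {}"
    using connectedD[OF conn opU, of "- closure U"] closure_subset[of U] by auto
  then have "- path_image c \<subseteq> closure U" using ne sub by auto
  then have "UNIV \<subseteq> T \<union> path_image c"
    using clU interior_subset[of T] by (auto simp: U_def)
  moreover have "bounded (T \<union> path_image c)" using T c(1) by (simp add: bounded_arc_image)
  ultimately have "bounded (UNIV :: plane set)" by (rule bounded_subset[rotated])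
  then show False by simp
qed

text \<open>A chord through an interior point, parallel to the bounding line, stays in the half plane.\<close>

lemma halfplane_hull_frontier:
  fixes T :: "plane set"
  assumes T: "bounded T" and m: "m \<noteq> 0" "n \<bullet> m = 0"
  shows "T \<inter> {x. n \<bullet> x \<ge> d} \<subseteq> convex hull (frontier T \<inter> {x. n \<bullet> x \<ge> d})"
proof
  fix x assume x: "x \<in> T \<inter> {x. n \<bullet> x \<ge> d}"
  show "x \<in> convex hull (frontier T \<inter> {x. n \<bullet> x \<ge> d})"
  proof (cases "x \<in> interior T")
    case True
    obtain s where s: "0 < s" "x + s *\<^sub>R m \<in> frontier T"
      using ray_to_frontier[OF T True m(1)] by blast
    obtain t where t: "0 < t" "x + t *\<^sub>R (- m) \<in> frontier T"
      using ray_to_frontier[OF T True, of "- m"] m(1) by (metis neg_equal_0_iff_equal)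
    define p where "p = x + s *\<^sub>R m"
    define q where "q = x + t *\<^sub>R (- m)"
    have pq: "p \<in> frontier T \<inter> {x. n \<bullet> x \<ge> d}" "q \<in> frontier T \<inter> {x. n \<bullet> x \<ge> d}"
      using s t x m(2) by (auto simp: p_def q_def inner_add_right inner_diff_right)
    have "t / (s + t) + s / (s + t) = 1"
      using s(1) t(1) by (simp add: add_divide_distrib[symmetric])
    then have "(t / (s + t)) *\<^sub>R p + (s / (s + t)) *\<^sub>R q = x"
      unfolding p_def q_def
      by (simp add: scaleR_add_right scaleR_left_distrib[symmetric] algebra_simps flip: scaleR_add_left)
    moreover have "(t / (s + t)) *\<^sub>R p + (s / (s + t)) *\<^sub>R q \<in> convex hull (frontier T \<inter> {x. n \<bullet> x \<ge> d})"
      using pq s(1) t(1) \<open>t / (s + t) + s / (s + t) = 1\<close>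
      by (intro convexD[OF convex_convex_hull]) (auto intro: hull_inc)
    ultimately show ?thesis by simp
  next
    case False
    then have "x \<in> frontier T" using x closure_subset by (auto simp: frontier_def)
    then show ?thesis using x by (intro hull_inc) auto
  qed
qed

text \<open>A boundary point on the line outside the chord would put one of the points \<open>D\<close>, \<open>E\<close> strictly between itself
and the midpoint of the chord, hence into the interior.\<close>

lemma frontier_meets_chord_line:
  fixes T :: "plane set"
  assumes T: "convex T" "closed T" and DE: "D \<in> frontier T" "E \<in> frontier T" "D \<noteq> E"
    and chord: "open_segment D E \<subseteq> interior T"
    and n: "norm n = 1" "n \<bullet> D = d" "n \<bullet> E = d"
  shows "frontier T \<inter> {x. n \<bullet> x = d} = {D, E}"
proof
  show "{D, E} \<subseteq> frontier T \<inter> {x. n \<bullet> x = d}" using DE n by auto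
  show "frontier T \<inter> {x. n \<bullet> x = d} \<subseteq> {D, E}"
  proof
    fix z assume "z \<in> frontier T \<inter> {x. n \<bullet> x = d}"
    then have z: "z \<in> frontier T" "n \<bullet> z = d" by auto
    have fi: "frontier T \<inter> interior T = {}" by (auto simp: frontier_def)
    have fT: "frontier T \<subseteq> T" using T(2) by (simp add: frontier_subset_closed)
    define m where "m = midpoint D E"
    have mi: "m \<in> interior T" using chord DE(3) midpoint_in_open_segment by (auto simp: m_def)
    have seg: "open_segment m z \<subseteq> interior T"
      using in_interior_closure_convex_segment[OF T(1) mi] z fT closure_subset by blast
    define w where "w = (1 / norm (E - D)) *\<^sub>R (E - D)"
    have "z - D = ((z - D) \<bullet> w) *\<^sub>R w"
      using n z DE(3)
      by (intro collinear_orthogonal[of n]) (auto simp: w_def inner_diff_right inner_diff_left inner_commute)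
    then obtain s where s: "z - D = s *\<^sub>R (E - D)" by (metis scaleR_scaleR w_def)
    have z': "z = D + s *\<^sub>R (E - D)" using s by (simp add: algebra_simps)
    have m': "m = D + (1/2) *\<^sub>R (E - D)" by (simp add: m_def midpoint_def vec_eq_iff field_simps)
    have inside: False if "p \<in> frontier T" "p \<in> open_segment m z" for p
      using that seg fi by auto
    consider "0 \<le> s" "s \<le> 1" | "s < 0" | "1 < s" by linarith
    then show "z \<in> {D, E}"
    proof cases
      case 1
      then have "z \<in> closed_segment D E"
        unfolding in_segment using z' by (intro exI[of _ s]) (simp add: algebra_simps)
      then show ?thesis using chord z(1) fi by (auto simp: closed_segment_eq_open)
    next
      case 2
      define r where "r = (1/2) / (1/2 - s)"
      have r: "0 < r" "r < 1" "(1/2 - s) * r = 1/2" using 2 by (auto simp: r_def field_simps)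
      have "(1 - r) *\<^sub>R m + r *\<^sub>R z = D + (1/2 - (1/2 - s) * r) *\<^sub>R (E - D)"
        unfolding z' m' by (simp add: vec_eq_iff field_simps)
      then have "D = (1 - r) *\<^sub>R m + r *\<^sub>R z" by (simp add: r)
      moreover have "m \<noteq> z" using mi z fi by auto
      ultimately show ?thesis using inside[OF DE(1)] r unfolding in_segment by blast
    next
      case 3
      define r where "r = (1/2) / (s - 1/2)"
      have r: "0 < r" "r < 1" "(s - 1/2) * r = 1/2" using 3 by (auto simp: r_def field_simps)
      have "(1 - r) *\<^sub>R m + r *\<^sub>R z = D + (1/2 + (s - 1/2) * r) *\<^sub>R (E - D)"
        unfolding z' m' by (simp add: vec_eq_iff field_simps)
      then have "E = (1 - r) *\<^sub>R m + r *\<^sub>R z" by (simp add: r)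
      moreover have "m \<noteq> z" using mi z fi by auto
      ultimately show ?thesis using inside[OF DE(2)] r unfolding in_segment by blast
    qed
  qed
qed

section \<open>Meshes and interface elements\<close>

lemma triangular_meshD:
  assumes "triangular_mesh P \<T>"
  shows "finite \<T>" "T \<in> \<T> \<Longrightarrow> 2 simplex T"
    "T \<in> \<T> \<Longrightarrow> T' \<in> \<T> \<Longrightarrow> (T \<inter> T') face_of T"
    "\<Union>\<T> = closure (Omega P)" "\<Union>(boundary_edges P \<T>) = frontier (Omega P)"
  using assms by (auto simp: triangular_mesh_def triangulation_def)

text \<open>The common part of two elements is a face of both, and a face that meets the relative interior of an
edge contains the edge.\<close>

lemma mesh_edge_shared:
  assumes mesh: "triangular_mesh P \<T>" and T: "T \<in> \<T>" "T' \<in> \<T>"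
    and e: "e \<in> tri_edges T" and x: "x \<in> rel_interior e" "x \<in> T'"
  shows "e \<in> tri_edges T'"
proof -
  have f: "e face_of T" "aff_dim e = 1" using e by (auto simp: tri_edges_def edge_of_def)
  then have eT: "e \<subseteq> T" by (simp add: face_of_imp_subset)
  have "x \<in> T" using x(1) eT rel_interior_subset by blast
  then have "(T \<inter> T') \<inter> rel_interior e \<noteq> {}" using x by auto
  then have "e \<subseteq> T \<inter> T'"
    using subset_of_face_of[OF triangular_meshD(3)[OF mesh T] eT] by blast
  then have "e face_of (T \<inter> T')"
    using f(1) face_of_subset inf_le1 by blast
  moreover have "(T \<inter> T') face_of T'"
    using triangular_meshD(3)[OF mesh T(2) T(1)] by (simp add: Int_commute)
  ultimately have "e face_of T'" using face_of_trans by blast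
  then show ?thesis using f by (auto simp: tri_edges_def edge_of_def)
qed

text \<open>The boundary of the domain consists of edges.  An edge of \<open>T'\<close> through an interior point of \<open>T\<close> would contain \<open>T\<close>,
because the intersection of the two elements, being a face of \<open>T\<close>, would be all of \<open>T\<close>.\<close>

lemma mesh_interior_subset:
  assumes mesh: "triangular_mesh P \<T>" and op: "open (Omega P)" and T: "T \<in> \<T>"
  shows "interior T \<subseteq> Omega P"
proof
  fix x assume x: "x \<in> interior T"
  have Ts: "2 simplex T" using triangular_meshD(2)[OF mesh T] .
  have "x \<in> closure (Omega P)"
    using x interior_subset triangular_meshD(4)[OF mesh] T by blast
  moreover have "x \<notin> frontier (Omega P)"
  proof
    assume "x \<in> frontier (Omega P)"
    then obtain e where "e \<in> boundary_edges P \<T>" "x \<in> e"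
      using triangular_meshD(5)[OF mesh] by blast
    then obtain T' where T': "T' \<in> \<T>" "e \<in> tri_edges T'" "x \<in> e"
      by (auto simp: boundary_edges_def mesh_edges_def)
    then have f: "e face_of T'" "aff_dim e = 1" by (auto simp: tri_edges_def edge_of_def)
    then have "x \<in> T'" using T'(3) face_of_imp_subset by blast
    have xr: "x \<in> rel_interior T" using x triangle_basic(5)[OF Ts] by simp
    have "T \<subseteq> T \<inter> T'"
      using subset_of_face_of[OF triangular_meshD(3)[OF mesh T T'(1)], of T] xr \<open>x \<in> T'\<close>
        rel_interior_subset by blast
    then have "T \<subseteq> e" using subset_of_face_of[OF f(1), of T] xr T'(3) by blast
    then have "aff_dim T \<le> aff_dim e" by (rule aff_dim_subset)
    then show False using f(2) triangle_basic(3)[OF Ts] by simp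
  qed
  ultimately show "x \<in> Omega P" using op by (simp add: frontier_def interior_open)
qed

text \<open>A point with maximal second coordinate among the points of the marked elements on a vertical
  line that misses all vertices lies inside an edge; the element on the other side of this edge
  would contain points further up.\<close>

lemma marked_elements_reach_boundary:
  assumes mesh: "triangular_mesh P \<T>" and op: "open (Omega P)"
    and S: "S \<subseteq> \<T>" "S \<noteq> {}"
    and nb: "\<And>T T' e. T \<in> S \<Longrightarrow> T' \<in> \<T> \<Longrightarrow> e \<in> tri_edges T \<Longrightarrow> e \<in> tri_edges T' \<Longrightarrow> T' \<in> S"
  shows "\<exists>T\<in>S. \<exists>e\<in>tri_edges T. e \<in> boundary_edges P \<T>"
proof -
  have simp2: "2 simplex T" if "T \<in> \<T>" for T using triangular_meshD(2)[OF mesh that] .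
  have finT: "finite \<T>" using triangular_meshD(1)[OF mesh] .
  have finS: "finite S" using S finT finite_subset by blast
  define V :: "plane set" where "V = {x. \<exists>T\<in>\<T>. {x} face_of T}"
  have finV: "finite V"
  proof -
    have "finite {x. {x} face_of T}" if T: "T \<in> \<T>" for T
    proof -
      obtain C where "finite C" "T = convex hull C"
        using triangle_vertices[OF simp2[OF T]] by metis
      moreover have "x \<in> C" if "{x} face_of T" for x
        using that extreme_point_of_convex_hull[of x C] \<open>T = convex hull C\<close>
        by (simp add: face_of_singleton)
      ultimately show ?thesis using finite_subset[of "{x. {x} face_of T}" C] by blast
    qed
    moreover have "V = (\<Union>T\<in>\<T>. {x. {x} face_of T})" by (auto simp: V_def)
    ultimately show ?thesis using finT by simp
  qed
  obtain T0 where T0: "T0 \<in> S" using S by auto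
  obtain p \<epsilon> where p: "\<epsilon> > 0" "ball p \<epsilon> \<subseteq> interior T0"
    using triangle_basic(4)[OF simp2, of T0] T0 S(1) open_contains_ball[of "interior T0"] by blast
  have "infinite {p$1<..<p$1 + \<epsilon>}" using p(1) by simp
  then obtain s where s: "p$1 < s" "s < p$1 + \<epsilon>" "s \<notin> (\<lambda>x. x$1) ` V"
    using finV by (metis finite_imageI finite_subset greaterThanLessThan_iff subsetI)
  define L where "L = {x::plane. x$1 = s}"
  define K where "K = \<Union>S \<inter> L"
  have "compact K" unfolding K_def
  proof (rule compact_Int_closed)
    show "compact (\<Union>S)" using finS S(1) simp2 triangle_basic(1) by (intro compact_Union) auto
    show "closed L" unfolding L_def by (intro closed_Collect_eq continuous_intros)
  qed
  moreover have "K \<noteq> {}"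
  proof -
    define q where "q = p + (s - p$1) *\<^sub>R axis 1 1"
    have "dist p q < \<epsilon>" using s by (simp add: q_def dist_norm norm_axis_1)
    then have "q \<in> ball p \<epsilon>" by simp
    then have "q \<in> T0" using p(2) interior_subset by blast
    moreover have "q$1 = s" by (simp add: q_def)
    ultimately show ?thesis using T0 by (auto simp: K_def L_def)
  qed
  moreover have "continuous_on K (\<lambda>x. x$2)" by (intro continuous_intros)
  ultimately obtain x where x: "x \<in> K" "\<And>y. y \<in> K \<Longrightarrow> y$2 \<le> x$2"
    using continuous_attains_sup by metis
  obtain T where T: "T \<in> S" "x \<in> T" using x by (auto simp: K_def)
  have TT: "T \<in> \<T>" using T S by auto
  define u where "u k = x + (1 / real (Suc k)) *\<^sub>R axis 2 1" for k
  have uL: "u k \<in> L" for k using x(1) by (simp add: u_def K_def L_def axis_def)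
  have uout: "u k \<notin> \<Union>S" for k
    using x(2)[of "u k"] uL[of k] by (auto simp: K_def u_def)
  have ulim: "u \<longlonglongrightarrow> x"
  proof -
    have "(\<lambda>k. x + (1 / real (Suc k)) *\<^sub>R axis 2 1) \<longlonglongrightarrow> x + 0 *\<^sub>R axis 2 (1::real)"
      by (intro tendsto_intros LIMSEQ_inverse_real_of_nat[unfolded inverse_eq_divide])
    then show ?thesis by (simp add: u_def[abs_def])
  qed
  have "x \<notin> interior T"
  proof
    assume "x \<in> interior T"
    then have "\<forall>\<^sub>F k in sequentially. u k \<in> interior T"
      using ulim topological_tendstoD open_interior by blast
    then obtain k where "u k \<in> interior T" by (meson eventually_happens sequentially_bot)
    then show False using uout[of k] T interior_subset by blast
  qed
  then have "x \<in> frontier T" using T(2) closure_subset by (auto simp: frontier_def)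
  then obtain e where e: "e \<in> tri_edges T" "x \<in> e" using triangle_frontier[OF simp2[OF TT]] by auto
  have inner: "x \<in> rel_interior d" if d: "T' \<in> \<T>" "d \<in> tri_edges T'" "x \<in> d" for T' d
  proof -
    obtain a b where ab: "a \<noteq> b" "d = closed_segment a b"
      by (rule tri_edge_segment[OF simp2[OF d(1)] d(2)])
    have "d face_of T'" using d by (auto simp: tri_edges_def edge_of_def)
    moreover have "{a} face_of d" "{b} face_of d"
      using ab by (simp_all add: face_of_singleton extreme_point_of_segment)
    ultimately have "{a} face_of T'" "{b} face_of T'" using face_of_trans by blast+
    then have "a \<in> V" "b \<in> V" using d(1) by (auto simp: V_def)
    moreover have "x$1 = s" using x by (simp add: K_def L_def)
    ultimately have "x \<noteq> a" "x \<noteq> b" using s by auto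
    then show ?thesis using d(3) ab by (auto simp: rel_interior_closed_segment open_segment_def)
  qed
  \<comment> \<open>If \<open>e\<close> were an inner edge, a neighbourhood of \<open>x\<close> would be covered by the mesh; one of the finitely
    many elements contains points above \<open>x\<close> arbitrarily close to \<open>x\<close>, and it shares the edge \<open>e\<close>.\<close>
  have "e \<in> boundary_edges P \<T>"
  proof (rule ccontr)
    assume ne: "e \<notin> boundary_edges P \<T>"
    have "x \<notin> frontier (Omega P)"
    proof
      assume "x \<in> frontier (Omega P)"
      then obtain d where d: "d \<in> boundary_edges P \<T>" "x \<in> d"
        using triangular_meshD(5)[OF mesh] by blast
      then obtain T' where T': "T' \<in> \<T>" "d \<in> tri_edges T'" by (auto simp: boundary_edges_def mesh_edges_def)
      have "x \<in> T'" using T' d(2) by (auto simp: tri_edges_def edge_of_def dest: face_of_imp_subset)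
      then have e': "e \<in> tri_edges T'"
        using mesh_edge_shared[OF mesh TT T'(1) e(1) inner[OF TT e]] by blast
      have "d face_of T'" "e face_of T'" using T' e' by (auto simp: tri_edges_def edge_of_def)
      then have "e = d"
        using face_of_eq[of d T' e] inner[OF TT e] inner[OF T' d(2)] by blast
      then show False using d ne by simp
    qed
    moreover have "x \<in> closure (Omega P)" using T TT triangular_meshD(4)[OF mesh] by blast
    ultimately have "x \<in> Omega P" using op by (simp add: frontier_def interior_open)
    then have "\<forall>\<^sub>F k in sequentially. u k \<in> Omega P" using ulim topological_tendstoD op by blast
    then have ev: "\<forall>\<^sub>F k in sequentially. u k \<in> \<Union>\<T>"
      by (rule eventually_mono) (use closure_subset triangular_meshD(4)[OF mesh] in blast)
    have "\<exists>T'\<in>\<T>. \<exists>\<^sub>F k in sequentially. u k \<in> T'"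
    proof (rule ccontr)
      assume "\<not> ?thesis"
      then have "\<forall>T'\<in>\<T>. \<forall>\<^sub>F k in sequentially. u k \<notin> T'" by (simp add: frequently_def)
      then have "\<forall>\<^sub>F k in sequentially. \<forall>T'\<in>\<T>. u k \<notin> T'"
        using finT by (simp add: eventually_ball_finite)
      then have "\<forall>\<^sub>F k in sequentially. False" using ev by eventually_elim auto
      then show False by simp
    qed
    then obtain T' where T': "T' \<in> \<T>" "\<exists>\<^sub>F k in sequentially. u k \<in> T'" by blast
    have "x \<in> T'"
    proof (rule ccontr)
      assume "x \<notin> T'"
      moreover have "closed T'" using triangle_basic(1)[OF simp2[OF T'(1)]] by (rule compact_imp_closed)
      ultimately have "\<forall>\<^sub>F k in sequentially. u k \<in> - T'"
        using ulim topological_tendstoD[of u x sequentially "- T'"] by (auto simp: open_Compl)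
      then show False using T'(2) by (simp add: frequently_def)
    qed
    then have "e \<in> tri_edges T'" using mesh_edge_shared[OF mesh TT T'(1) e(1) inner[OF TT e]] by blast
    then have "T' \<in> S" using nb T(1) T'(1) e(1) by blast
    then show False using T'(2) uout frequently_ex[OF T'(2)] by blast
  qed
  then show ?thesis using T e by blast
qed

lemma arc_inner_subset_closed:
  fixes c :: "real \<Rightarrow> 'a::topological_space"
  assumes c: "path c" and K: "closed K" "\<And>t. 0 < t \<Longrightarrow> t < 1 \<Longrightarrow> c t \<in> K"
  shows "path_image c \<subseteq> K"
proof -
  have "closure {0<..<1::real} = {0..1}" by (simp add: closure_greaterThanLessThan)
  then have "continuous_on (closure {0<..<1}) c" using c by (simp add: path_def)
  then have "c ` closure {0<..<1} \<subseteq> K"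
    by (rule image_closure_subset) (use K in auto)
  then show ?thesis using \<open>closure {0<..<1::real} = {0..1}\<close> by (simp add: path_image_def)
qed

text \<open>The curve inside an interface element may wander across the chord \<open>DE\<close>, but along the boundary
  of the element the two subdomains are separated exactly by the line through \<open>D\<close> and \<open>E\<close>.\<close>

lemma interface_element_cut:
  assumes P: "interface_setting P" and mesh: "triangular_mesh P \<T>" and res: "interface_resolved P \<T>"
    and T: "T \<in> interface_elements P \<T>"
  obtains D E n d where "D \<noteq> E" "interface P \<inter> frontier T = {D, E}"
    "norm n = 1" "n \<bullet> D = d" "n \<bullet> E = d" "frontier T \<inter> {x. n \<bullet> x = d} = {D, E}"
    "cut_part (Omega_p P) T = T \<inter> {x. n \<bullet> x \<ge> d}" "cut_part (Omega_m P) T = T \<inter> {x. n \<bullet> x \<le> d}"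
    "\<forall>x\<in>frontier T. n \<bullet> x > d \<longrightarrow> (\<exists>\<epsilon>>0. ball x \<epsilon> \<inter> interior T \<subseteq> Omega_p P)"
    "\<forall>x\<in>frontier T. n \<bullet> x < d \<longrightarrow> (\<exists>\<epsilon>>0. ball x \<epsilon> \<inter> interior T \<subseteq> Omega_m P)"
proof -
  have TT: "T \<in> \<T>" and meet: "interior T \<inter> interface P \<noteq> {}"
    using T by (auto simp: interface_elements_def)
  have Ts: "2 simplex T" using triangular_meshD(2)[OF mesh TT] .
  note tb = triangle_basic[OF Ts]
  have bT: "bounded T" and cT: "closed T" using tb(1) by (auto simp: compact_imp_closed compact_imp_bounded)
  obtain D E c where DE: "D \<noteq> E" "interface P \<inter> frontier T = {D, E}"
      "\<forall>e\<in>tri_edges T. \<not> {D, E} \<subseteq> e"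
    and c: "arc c" "pathstart c = D" "pathfinish c = E" "path_image c = interface P \<inter> T"
    using res T unfolding interface_resolved_def by metis
  have op: "open (Omega P)" "open (Omega_p P)" "open (Omega_m P)" "Omega_p P \<inter> Omega_m P = {}"
    and part: "Omega P - interface P = Omega_p P \<union> Omega_m P"
    and fr: "Omega P \<inter> interface P \<subseteq> frontier (Omega_p P) \<inter> frontier (Omega_m P)"
    and sp: "simple_path (curve P)"
    using P by (auto simp: interface_setting_def)
  have clJ: "closed (interface P)"
    using sp by (simp add: simple_path_imp_path closed_path_image)
  have iO: "interior T \<subseteq> Omega P" using mesh_interior_subset[OF mesh op(1) TT] .
  have iT: "interior T - interface P \<subseteq> Omega_p P \<union> Omega_m P" using iO part by auto
  have DEf: "D \<in> frontier T" "E \<in> frontier T" using DE(2) by auto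
  have DET: "D \<in> T" "E \<in> T" using DEf frontier_subset_closed[OF cT] by auto
  have chord: "open_segment D E \<subseteq> interior T"
    using open_segment_interior_triangle[OF Ts DET DE(1,3)] .
  \<comment> \<open>the direction of the chord, rotated by a right angle\<close>
  define n0 :: plane where "n0 = (1 / norm (E - D)) *\<^sub>R vector [- (E - D)$2, (E - D)$1]"
  have n0: "norm n0 = 1" "n0 \<bullet> (E - D) = 0"
  proof -
    have "norm (vector [- (E - D)$2, (E - D)$1] :: plane) = norm (E - D)"
      by (simp add: norm_vec_def L2_set_def sum_2 add.commute power2_commute)
    then show "norm n0 = 1" using DE(1) by (simp add: n0_def)
    have "(vector [- (E - D)$2, (E - D)$1] :: plane) \<bullet> (E - D) = 0"
      by (simp add: inner_vec_def sum_2 algebra_simps)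
    then show "n0 \<bullet> (E - D) = 0" by (simp only: n0_def inner_scaleR_left mult_zero_right)
  qed
  \<comment> \<open>Along each of the two sides of the chord the element lies in one subdomain, and these are different.\<close>
  have side: "(\<forall>x\<in>frontier T \<inter> {x. n \<bullet> x > d}. \<exists>\<epsilon>>0. ball x \<epsilon> \<inter> interior T \<subseteq> Omega_p P) \<or>
     (\<forall>x\<in>frontier T \<inter> {x. n \<bullet> x > d}. \<exists>\<epsilon>>0. ball x \<epsilon> \<inter> interior T \<subseteq> Omega_m P)"
    if "n \<bullet> D = d" "n \<bullet> E = d" for n d
  proof (rule one_sided_along_connected[OF tb(2,6) op(2,3,4) clJ iT])
    show "connected (frontier T \<inter> {x. n \<bullet> x > d})"
      using side_path_connected[OF Ts] path_connected_imp_connected by blast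
    show "frontier T \<inter> {x. n \<bullet> x > d} \<inter> interface P = {}"
      using DE(2) that by fastforce
  qed auto
  have two: False if X: "(X, Y) = (Omega_p P, Omega_m P) \<or> (X, Y) = (Omega_m P, Omega_p P)"
    and nd: "norm n = 1" "n \<bullet> D = d" "n \<bullet> E = d"
    and sd: "\<forall>x\<in>frontier T \<inter> {x. n \<bullet> x > d}. \<exists>\<epsilon>>0. ball x \<epsilon> \<inter> interior T \<subseteq> X"
            "\<forall>x\<in>frontier T \<inter> {x. (- n) \<bullet> x > - d}. \<exists>\<epsilon>>0. ball x \<epsilon> \<inter> interior T \<subseteq> X"
    for X Y n d
  proof -
    have "interior T \<inter> Y = {}"
    proof (rule arc_cut_two_sides[OF bT cT, of X Y c D E])
      show "interior T - path_image c \<subseteq> X \<union> Y" using iT X c(4) interior_subset by blast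
      show "path_image c \<inter> frontier T = {D, E}"
        using c(4) DE(2) frontier_subset_closed[OF cT] by auto
      fix x assume x: "x \<in> frontier T - {D, E}"
      then have "n \<bullet> x \<noteq> d"
        using frontier_meets_chord_line[OF tb(2) cT DEf DE(1) chord nd] by blast
      then show "\<exists>\<epsilon>>0. ball x \<epsilon> \<inter> interior T \<subseteq> X"
        using sd x by (cases "n \<bullet> x > d") auto
    next
      show "Y \<inter> path_image c = {}" using X c(4) part by auto
    qed (use X op c in auto)
    moreover obtain y where y: "y \<in> interior T" "y \<in> interface P" using meet by auto
    then have "y \<in> closure Y" using iO fr X by (auto simp: frontier_def)
    then have "interior T \<inter> Y \<noteq> {}"
      using y open_Int_closure_eq_empty[of "interior T" Y] by auto
    ultimately show False by simp
  qed
  have ex: "\<exists>n d. norm n = 1 \<and> n \<bullet> D = d \<and> n \<bullet> E = d \<and>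
     (\<forall>x\<in>frontier T \<inter> {x. n \<bullet> x > d}. \<exists>\<epsilon>>0. ball x \<epsilon> \<inter> interior T \<subseteq> Omega_p P) \<and>
     (\<forall>x\<in>frontier T \<inter> {x. n \<bullet> x < d}. \<exists>\<epsilon>>0. ball x \<epsilon> \<inter> interior T \<subseteq> Omega_m P)"
  proof -
    define d0 where "d0 = n0 \<bullet> D"
    define Q where "Q n d X \<longleftrightarrow> (\<forall>x\<in>frontier T \<inter> {x. n \<bullet> x > d}. \<exists>\<epsilon>>0. ball x \<epsilon> \<inter> interior T \<subseteq> X)"
      for n :: plane and d X
    have a: "n0 \<bullet> D = d0" "n0 \<bullet> E = d0" using n0(2) by (auto simp: d0_def inner_diff_right)
    have b: "(- n0) \<bullet> D = - d0" "(- n0) \<bullet> E = - d0" using a by auto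
    have "Q n0 d0 (Omega_p P) \<or> Q n0 d0 (Omega_m P)"
      using side[OF a] unfolding Q_def .
    moreover have "Q (- n0) (- d0) (Omega_p P) \<or> Q (- n0) (- d0) (Omega_m P)"
      using side[OF b] unfolding Q_def .
    moreover have "\<not> (Q n0 d0 (Omega_p P) \<and> Q (- n0) (- d0) (Omega_p P))"
      using two[of "Omega_p P" "Omega_m P" n0 d0] n0(1) a unfolding Q_def by blast
    moreover have "\<not> (Q n0 d0 (Omega_m P) \<and> Q (- n0) (- d0) (Omega_m P))"
      using two[of "Omega_m P" "Omega_p P" n0 d0] n0(1) a unfolding Q_def by blast
    ultimately have "(Q n0 d0 (Omega_p P) \<and> Q (- n0) (- d0) (Omega_m P)) \<or>
        (Q (- n0) (- d0) (Omega_p P) \<and> Q (- (- n0)) (- (- d0)) (Omega_m P))"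
      by (simp only: minus_minus) argo
    moreover have "norm (- n0) = 1" using n0(1) by simp
    ultimately obtain n d where "norm n = 1" "n \<bullet> D = d" "n \<bullet> E = d"
        "Q n d (Omega_p P)" "Q (- n) (- d) (Omega_m P)"
      using n0(1) a b by metis
    moreover have "{x. (- n) \<bullet> x > - d} = {x. n \<bullet> x < d}" by auto
    ultimately show ?thesis unfolding Q_def by metis
  qed
  then obtain n d where nd: "norm n = 1" "n \<bullet> D = d" "n \<bullet> E = d"
    and sp: "\<And>x. x \<in> frontier T \<Longrightarrow> n \<bullet> x > d \<Longrightarrow> \<exists>\<epsilon>>0. ball x \<epsilon> \<inter> interior T \<subseteq> Omega_p P"
    and sm: "\<And>x. x \<in> frontier T \<Longrightarrow> n \<bullet> x < d \<Longrightarrow> \<exists>\<epsilon>>0. ball x \<epsilon> \<inter> interior T \<subseteq> Omega_m P"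
    by (metis (no_types, lifting) IntI mem_Collect_eq)
  have line: "frontier T \<inter> {x. n \<bullet> x = d} = {D, E}"
    by (rule frontier_meets_chord_line[OF tb(2) cT DEf DE(1) chord nd])
  \<comment> \<open>The curve is part of both frontiers, so its end points on the element are limits from both subdomains.\<close>
  have DEcl: "D \<in> closure (interior T \<inter> X) \<and> E \<in> closure (interior T \<inter> X)"
    if X: "X = Omega_p P \<or> X = Omega_m P" for X
  proof -
    have "path_image c \<subseteq> closure (interior T \<inter> X)"
    proof (rule arc_inner_subset_closed)
      fix t :: real assume t: "0 < t" "t < 1"
      have ci: "c t \<in> path_image c" using t by (auto simp: path_image_def)
      have "c t \<noteq> D" "c t \<noteq> E"
        using c(1-3) t arc_imp_simple_path[OF c(1)] unfolding arc_def inj_on_def pathstart_def pathfinish_def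
        by (metis atLeastAtMost_iff less_eq_real_def less_irrefl zero_le_one)+
      then have "c t \<notin> frontier T" using ci c(4) DE(2) by auto
      then have cint: "c t \<in> interior T" using ci c(4) closure_subset by (auto simp: frontier_def)
      then have "c t \<in> closure X" using ci c(4) iO fr X by (auto simp: frontier_def)
      then show "c t \<in> closure (interior T \<inter> X)"
        using cint open_Int_closure_subset[OF open_interior] by blast
    qed (use c in \<open>auto simp: arc_imp_path\<close>)
    then show ?thesis using c pathstart_in_path_image pathfinish_in_path_image by blast
  qed
  have trace: "frontier T \<inter> closure (interior T \<inter> X) = frontier T \<inter> {x. m \<bullet> x \<ge> b}"
    if XY: "X = Omega_p P \<or> X = Omega_m P" "X \<inter> Y = {}"
      and m: "m \<bullet> D = b" "m \<bullet> E = b" "frontier T \<inter> {x. m \<bullet> x = b} = {D, E}"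
      and up: "\<And>x. x \<in> frontier T \<Longrightarrow> m \<bullet> x > b \<Longrightarrow> \<exists>\<epsilon>>0. ball x \<epsilon> \<inter> interior T \<subseteq> X"
      and dn: "\<And>x. x \<in> frontier T \<Longrightarrow> m \<bullet> x < b \<Longrightarrow> \<exists>\<epsilon>>0. ball x \<epsilon> \<inter> interior T \<subseteq> Y"
    for X Y m b
  proof (intro equalityI subsetI IntI CollectI)
    fix x assume x: "x \<in> frontier T \<inter> closure (interior T \<inter> X)"
    show "m \<bullet> x \<ge> b"
    proof (rule ccontr)
      assume "\<not> m \<bullet> x \<ge> b"
      then obtain \<epsilon> where "\<epsilon> > 0" "ball x \<epsilon> \<inter> interior T \<subseteq> Y" using dn x by (meson IntD1 not_le)
      then show False using ball_meets_closure[of x "interior T \<inter> X" \<epsilon>] x XY(2) by blast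
    qed
    show "x \<in> frontier T" using x by simp
  next
    fix x assume x: "x \<in> frontier T \<inter> {x. m \<bullet> x \<ge> b}"
    show "x \<in> frontier T" using x by simp
    show "x \<in> closure (interior T \<inter> X)"
    proof (cases "m \<bullet> x = b")
      case True
      then have "x \<in> {D, E}" using x m(3) by auto
      then show ?thesis using DEcl[OF XY(1)] by auto
    next
      case False
      then obtain \<epsilon> where e: "\<epsilon> > 0" "ball x \<epsilon> \<inter> interior T \<subseteq> X" using up x by force
      have "x \<in> closure (interior T)"
        using x tb(6) frontier_subset_closed[OF cT] by blast
      then have "x \<in> closure (ball x \<epsilon> \<inter> interior T)"
        using e open_Int_closure_subset[of "ball x \<epsilon>" "interior T"] by auto
      moreover have "ball x \<epsilon> \<inter> interior T \<subseteq> interior T \<inter> X" using e by auto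
      ultimately show ?thesis using closure_mono by blast
    qed
  qed
  have hull: "convex hull (frontier T \<inter> {x. m \<bullet> x \<ge> b}) = T \<inter> {x. m \<bullet> x \<ge> b}"
    if m: "m \<bullet> (E - D) = 0" for m b
  proof
    show "convex hull (frontier T \<inter> {x. m \<bullet> x \<ge> b}) \<subseteq> T \<inter> {x. m \<bullet> x \<ge> b}"
      using frontier_subset_closed[OF cT] tb(2)
      by (intro hull_minimal) (auto intro: convex_Int simp: convex_halfspace_ge)
    show "T \<inter> {x. m \<bullet> x \<ge> b} \<subseteq> convex hull (frontier T \<inter> {x. m \<bullet> x \<ge> b})"
      using halfplane_hull_frontier[OF bT _ m] DE(1) by simp
  qed
  have cp: "cut_part (Omega_p P) T = T \<inter> {x. n \<bullet> x \<ge> d}"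
    unfolding cut_part_def
    using trace[of "Omega_p P" "Omega_m P" n d] hull[of n d] nd line sp sm op(4)
    by (simp add: inner_diff_right)
  have "frontier T \<inter> {x. (- n) \<bullet> x = - d} = {D, E}" using line by simp
  then have "frontier T \<inter> closure (interior T \<inter> Omega_m P) = frontier T \<inter> {x. (- n) \<bullet> x \<ge> - d}"
    using nd sp sm op(4) by (intro trace[of "Omega_m P" "Omega_p P" "- n" "- d"]) (auto simp: Int_commute)
  then have "cut_part (Omega_m P) T = T \<inter> {x. (- n) \<bullet> x \<ge> - d}"
    unfolding cut_part_def using hull[of "- n" "- d"] nd by (simp add: inner_diff_right)
  then have cm: "cut_part (Omega_m P) T = T \<inter> {x. n \<bullet> x \<le> d}" by simp
  show ?thesis by (rule that[OF DE(1,2) nd line cp cm]) (use sp sm in blast)+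
qed

section \<open>Local functions\<close>

text \<open>Affine functions and immersed finite element functions in one formula: across the line \<open>n \<bullet> x = d\<close> the gradient
jumps by \<open>\<mu>\<close> times its normal component on the side \<open>n \<bullet> x < d\<close>.\<close>

definition kink :: "plane set \<Rightarrow> plane \<Rightarrow> real \<Rightarrow> real \<Rightarrow> real \<Rightarrow> plane \<Rightarrow> plane \<Rightarrow> real" where
  "kink T n d \<mu> a G x = (if x \<in> T then a + G \<bullet> x + \<mu> * (G \<bullet> n) * max 0 (n \<bullet> x - d) else 0)"

definition kink_grad :: "plane \<Rightarrow> real \<Rightarrow> real \<Rightarrow> plane \<Rightarrow> plane \<Rightarrow> plane" where
  "kink_grad n d \<mu> G x = (if n \<bullet> x > d then G + (\<mu> * (G \<bullet> n)) *\<^sub>R n else G)"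

lemma kink_comb:
  "(\<lambda>x. kink T n d \<mu> a G x + t * kink T n d \<mu> a' G' x) = kink T n d \<mu> (a + t * a') (G + t *\<^sub>R G')"
  by (auto simp: kink_def inner_add_left algebra_simps)

lemma kink_zero: "kink T n d \<mu> 0 0 = (\<lambda>x. 0)"
  by (auto simp: kink_def)

lemma kink_grad_comb:
  "kink_grad n d \<mu> (G + t *\<^sub>R G') x = kink_grad n d \<mu> G x + t *\<^sub>R kink_grad n d \<mu> G' x"
  by (simp add: kink_grad_def inner_add_left algebra_simps)

definition kinks :: "plane set \<Rightarrow> plane \<Rightarrow> real \<Rightarrow> real \<Rightarrow> (plane \<Rightarrow> real) set" where
  "kinks T n d \<mu> = {kink T n d \<mu> a G |a G. True}"

text \<open>The trace of the coefficient from inside of the element is constant on either side of the line.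
  The line meets the boundary in a finite set, which edge integrals do not see.\<close>

definition frame :: "interface_problem \<Rightarrow> plane set \<Rightarrow> plane \<Rightarrow> real \<Rightarrow> bool" where
  "frame P T n d \<longleftrightarrow> norm n = 1 \<and> finite (frontier T \<inter> {x. n \<bullet> x = d}) \<and>
     (\<exists>b1\<in>{beta_p P, beta_m P}. \<forall>x\<in>frontier T. n \<bullet> x > d \<longrightarrow>
        (\<forall>\<^sub>F y in at x within interior T. beta P y = b1)) \<and>
     (\<exists>b2\<in>{beta_p P, beta_m P}. \<forall>x\<in>frontier T. n \<bullet> x < d \<longrightarrow>
        (\<forall>\<^sub>F y in at x within interior T. beta P y = b2))"

definition slope_jump :: "interface_problem \<Rightarrow> real" where
  "slope_jump P = beta_m P / beta_p P - 1"

lemma eventually_at_within_ball: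
  assumes "\<epsilon> > 0" "\<And>y. y \<in> ball x \<epsilon> \<inter> S \<Longrightarrow> Q y"
  shows "\<forall>\<^sub>F y in at x within S. Q y"
  unfolding eventually_at using assms by (intro exI[of _ \<epsilon>]) (auto simp: dist_commute)

text \<open>The jump of the gradient of a shape function is orthogonal to the chord by continuity at its end points, and the
flux condition fixes its normal component.\<close>

lemma interface_element_frame:
  assumes P: "interface_setting P" and mesh: "triangular_mesh P \<T>" and res: "interface_resolved P \<T>"
    and T: "T \<in> interface_elements P \<T>"
  shows "\<exists>n d. frame P T n d \<and> IFE P T \<subseteq> kinks T n d (slope_jump P)"
proof -
  obtain D E n d where DE: "D \<noteq> E" "interface P \<inter> frontier T = {D, E}"
    and n: "norm n = 1" "n \<bullet> D = d" "n \<bullet> E = d" and line: "frontier T \<inter> {x. n \<bullet> x = d} = {D, E}"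
    and cut: "cut_part (Omega_p P) T = T \<inter> {x. n \<bullet> x \<ge> d}" "cut_part (Omega_m P) T = T \<inter> {x. n \<bullet> x \<le> d}"
    and up: "\<forall>x\<in>frontier T. n \<bullet> x > d \<longrightarrow> (\<exists>\<epsilon>>0. ball x \<epsilon> \<inter> interior T \<subseteq> Omega_p P)"
    and dn: "\<forall>x\<in>frontier T. n \<bullet> x < d \<longrightarrow> (\<exists>\<epsilon>>0. ball x \<epsilon> \<inter> interior T \<subseteq> Omega_m P)"
  proof (rule interface_element_cut[OF P mesh res T], goal_cases)
    case (1 D E n d)
    show ?case by (rule 1(1)[OF 1(2-11)])
  qed
  have pos: "0 < beta_p P" "0 < beta_m P" and disj: "Omega_p P \<inter> Omega_m P = {}"
    using P by (auto simp: interface_setting_def)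
  have ev1: "\<forall>\<^sub>F y in at x within interior T. beta P y = beta_p P"
    if x: "x \<in> frontier T" "n \<bullet> x > d" for x
  proof -
    obtain \<epsilon> where "\<epsilon> > 0" "ball x \<epsilon> \<inter> interior T \<subseteq> Omega_p P" using up x by blast
    then show ?thesis using disj by (intro eventually_at_within_ball[of \<epsilon>]) (auto simp: beta_def)
  qed
  have ev2: "\<forall>\<^sub>F y in at x within interior T. beta P y = beta_m P"
    if x: "x \<in> frontier T" "n \<bullet> x < d" for x
  proof -
    obtain \<epsilon> where "\<epsilon> > 0" "ball x \<epsilon> \<inter> interior T \<subseteq> Omega_m P" using dn x by blast
    then show ?thesis by (intro eventually_at_within_ball[of \<epsilon>]) (auto simp: beta_def)
  qed
  have fr: "frame P T n d" unfolding frame_def using n line ev1 ev2 by auto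
  have shape: "\<exists>a G. \<phi> = kink T n d (slope_jump P) a G" if sh: "ife_shape P T A \<phi>" for A \<phi>
  proof -
    obtain ap Gp am Gm D' E' where out: "\<forall>x. x \<notin> T \<longrightarrow> \<phi> x = 0"
      and DE': "interface P \<inter> frontier T = {D', E'}" "D' \<noteq> E'"
      and p: "\<forall>x\<in>T \<inter> {x. n \<bullet> x \<ge> d}. \<phi> x = ap + Gp \<bullet> x"
      and m: "\<forall>x\<in>T \<inter> {x. n \<bullet> x \<le> d}. \<phi> x = am + Gm \<bullet> x"
      and cD: "ap + Gp \<bullet> D' = am + Gm \<bullet> D'" and cE: "ap + Gp \<bullet> E' = am + Gm \<bullet> E'"
      and fl: "\<forall>m. m \<bullet> (E' - D') = 0 \<longrightarrow> beta_p P * (Gp \<bullet> m) = beta_m P * (Gm \<bullet> m)"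
      using sh unfolding ife_shape_def cut by (elim conjE exE, intro that)
    have "{D', E'} = {D, E}" using DE DE' by simp
    then have nD: "n \<bullet> D' = d" "n \<bullet> E' = d" using n by (auto simp: doubleton_eq_iff)
    then have orth: "n \<bullet> (E' - D') = 0" by (simp add: inner_diff_right)
    have "(Gp - Gm) \<bullet> (E' - D') = 0" using cD cE by (simp add: inner_diff_right inner_diff_left)
    then have mu: "Gp - Gm = ((Gp - Gm) \<bullet> n) *\<^sub>R n"
      using collinear_orthogonal[of "E' - D'" n "Gp - Gm"] orth n(1) DE'(2) by simp
    have "beta_p P * (Gp \<bullet> n) = beta_m P * (Gm \<bullet> n)" using fl orth by blast
    then have "(Gp - Gm) \<bullet> n = slope_jump P * (Gm \<bullet> n)"
      using pos by (simp add: slope_jump_def inner_diff_left field_simps)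
    then have Gp: "Gp = Gm + (slope_jump P * (Gm \<bullet> n)) *\<^sub>R n" using mu by (simp add: algebra_simps)
    have ap: "ap = am - slope_jump P * (Gm \<bullet> n) * d"
      using cD unfolding Gp by (simp add: inner_add_left nD)
    have "\<phi> x = kink T n d (slope_jump P) am Gm x" for x
    proof (cases "x \<in> T")
      case True
      show ?thesis
      proof (cases "n \<bullet> x \<ge> d")
        case up: True
        then have "\<phi> x = ap + Gp \<bullet> x" using p True by auto
        then show ?thesis using True up
          unfolding kink_def ap Gp by (simp add: inner_add_left algebra_simps)
      next
        case False
        then have "\<phi> x = am + Gm \<bullet> x" using m True by auto
        then show ?thesis using True False by (simp add: kink_def)
      qed
    next
      case False
      then show ?thesis using out by (simp add: kink_def)
    qed
    then show ?thesis by blast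
  qed
  have "IFE P T \<subseteq> kinks T n d (slope_jump P)"
  proof
    fix w assume "w \<in> IFE P T"
    then obtain F c where F: "finite F" "F \<subseteq> {\<phi>. \<exists>A\<in>tri_vertices T. ife_shape P T A \<phi>}"
        and w: "w = (\<lambda>x. \<Sum>\<phi>\<in>F. c \<phi> * \<phi> x)" by (auto simp: IFE_def)
    have "\<exists>a G. (\<lambda>x. \<Sum>\<phi>\<in>F. c \<phi> * \<phi> x) = kink T n d (slope_jump P) a G"
      using F
    proof (induction F rule: finite_induct)
      case empty
      then show ?case by (intro exI[of _ 0]) (simp add: kink_zero)
    next
      case (insert \<phi> F)
      obtain a G where 1: "(\<lambda>x. \<Sum>\<phi>\<in>F. c \<phi> * \<phi> x) = kink T n d (slope_jump P) a G"
        using insert by auto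
      obtain a' G' where 2: "\<phi> = kink T n d (slope_jump P) a' G'" using insert.prems shape by blast
      have "(\<lambda>x. \<Sum>\<phi>\<in>insert \<phi> F. c \<phi> * \<phi> x) = (\<lambda>x. (\<Sum>\<phi>\<in>F. c \<phi> * \<phi> x) + c \<phi> * \<phi> x)"
        using insert.hyps by (simp add: add.commute)
      also have "\<dots> = (\<lambda>x. kink T n d (slope_jump P) a G x + c \<phi> * kink T n d (slope_jump P) a' G' x)"
        using fun_cong[OF 1] 2 by simp
      finally show ?case unfolding kink_comb by blast
    qed
    then show "w \<in> kinks T n d (slope_jump P)" unfolding w kinks_def by blast
  qed
  then show ?thesis using fr by blast
qed

text \<open>For an element off the interface the line is moved beyond the element, where the kink is
  invisible.\<close>

lemma regular_element_frame:
  assumes P: "interface_setting P" and mesh: "triangular_mesh P \<T>"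
    and T: "T \<in> \<T> - interface_elements P \<T>"
  shows "\<exists>n d. frame P T n d \<and> P1 T \<subseteq> kinks T n d (slope_jump P)"
proof -
  have Ts: "2 simplex T" using triangular_meshD(2)[OF mesh] T by blast
  note tb = triangle_basic[OF Ts]
  have op: "open (Omega P)" "open (Omega_p P)" "open (Omega_m P)" "Omega_p P \<inter> Omega_m P = {}"
    and part: "Omega P - interface P = Omega_p P \<union> Omega_m P"
    using P by (auto simp: interface_setting_def)
  have "interior T \<inter> interface P = {}" using T by (auto simp: interface_elements_def)
  then have sub: "interior T \<subseteq> Omega_p P \<union> Omega_m P"
    using mesh_interior_subset[OF mesh op(1)] T part by blast
  have "connected (interior T)" using tb(2) by (intro convex_connected convex_interior)
  then have "Omega_p P \<inter> interior T = {} \<or> Omega_m P \<inter> interior T = {}"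
    using connectedD[of "interior T" "Omega_p P" "Omega_m P"] op sub by auto
  then have "\<exists>b\<in>{beta_p P, beta_m P}. \<forall>y\<in>interior T. beta P y = b"
    using sub unfolding beta_def by auto
  then obtain b where b: "b \<in> {beta_p P, beta_m P}" "\<forall>y\<in>interior T. beta P y = b" by blast
  have "bounded T" using tb(1) compact_imp_bounded by blast
  then obtain M where M: "\<And>x. x \<in> T \<Longrightarrow> norm x \<le> M" unfolding bounded_iff by blast
  define n :: plane where "n = axis 1 1"
  have n: "norm n = 1" by (simp add: n_def norm_axis_1)
  have lt: "n \<bullet> x < M + 1" if "x \<in> T" for x
    using norm_cauchy_schwarz[of n x] n M[OF that] by simp
  have fT: "frontier T \<subseteq> T" using tb(1) by (simp add: compact_imp_closed frontier_subset_closed)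
  have ev: "\<forall>\<^sub>F y in at x within interior T. beta P y = b" for x
    using b(2) by (intro eventually_at_within_ball[of 1]) auto
  have "frontier T \<inter> {x. n \<bullet> x = M + 1} = {}" using lt fT by fastforce
  then have fr: "frame P T n (M + 1)" unfolding frame_def using n b(1) ev by auto
  have "P1 T \<subseteq> kinks T n (M + 1) (slope_jump P)"
  proof
    fix w assume "w \<in> P1 T"
    then obtain a G where w: "\<forall>x\<in>T. w x = a + G \<bullet> x" "\<forall>x. x \<notin> T \<longrightarrow> w x = 0"
      by (auto simp: P1_def)
    have "w = kink T n (M + 1) (slope_jump P) a G"
      using w lt by (force simp: kink_def)
    then show "w \<in> kinks T n (M + 1) (slope_jump P)" unfolding kinks_def by blast
  qed
  then show ?thesis using fr by blast
qed

definition local_space :: "interface_problem \<Rightarrow> plane set set \<Rightarrow> plane set \<Rightarrow> (plane \<Rightarrow> real) set" where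
  "local_space P \<T> T = (if T \<in> interface_elements P \<T> then IFE P T else P1 T)"

lemma local_space_frame:
  assumes "interface_setting P" "triangular_mesh P \<T>" "interface_resolved P \<T>" "T \<in> \<T>"
  shows "\<exists>n d. frame P T n d \<and> local_space P \<T> T \<subseteq> kinks T n d (slope_jump P)"
  unfolding local_space_def
  using interface_element_frame[OF assms(1-3)] regular_element_frame[OF assms(1,2)] assms(4) by auto

lemma IFE_comb:
  assumes "u \<in> IFE P T" "v \<in> IFE P T"
  shows "(\<lambda>x. u x + t * v x) \<in> IFE P T"
proof -
  define \<Phi> where "\<Phi> = {\<phi>. \<exists>A\<in>tri_vertices T. ife_shape P T A \<phi>}"
  obtain F c where F: "finite F" "F \<subseteq> \<Phi>" "u = (\<lambda>x. \<Sum>\<phi>\<in>F. c \<phi> * \<phi> x)"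
    using assms(1) unfolding IFE_def \<Phi>_def by blast
  obtain F' c' where F': "finite F'" "F' \<subseteq> \<Phi>" "v = (\<lambda>x. \<Sum>\<phi>\<in>F'. c' \<phi> * \<phi> x)"
    using assms(2) unfolding IFE_def \<Phi>_def by blast
  define k where "k \<phi> = (if \<phi> \<in> F then c \<phi> else 0) + t * (if \<phi> \<in> F' then c' \<phi> else 0)" for \<phi>
  have "u x + t * v x = (\<Sum>\<phi>\<in>F \<union> F'. k \<phi> * \<phi> x)" for x
  proof -
    have "u x = (\<Sum>\<phi>\<in>F \<union> F'. (if \<phi> \<in> F then c \<phi> else 0) * \<phi> x)"
      unfolding F(3) using F F' by (intro sum.mono_neutral_cong_left) auto
    moreover have "v x = (\<Sum>\<phi>\<in>F \<union> F'. (if \<phi> \<in> F' then c' \<phi> else 0) * \<phi> x)"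
      unfolding F'(3) using F F' by (intro sum.mono_neutral_cong_left) auto
    ultimately show ?thesis
      by (simp add: k_def sum_distrib_left sum.distrib[symmetric] algebra_simps)
  qed
  then have "(\<lambda>x. u x + t * v x) = (\<lambda>x. \<Sum>\<phi>\<in>F \<union> F'. k \<phi> * \<phi> x)" by auto
  then show ?thesis unfolding IFE_def \<Phi>_def[symmetric] using F F' by blast
qed

lemma local_space_comb:
  assumes "u \<in> local_space P \<T> T" "v \<in> local_space P \<T> T"
  shows "(\<lambda>x. u x + t * v x) \<in> local_space P \<T> T"
proof (cases "T \<in> interface_elements P \<T>")
  case True
  then show ?thesis using assms IFE_comb by (simp add: local_space_def)
next
  case False
  then obtain a G a' G' where u: "\<forall>x\<in>T. u x = a + G \<bullet> x" "\<forall>x. x \<notin> T \<longrightarrow> u x = 0"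
    and v: "\<forall>x\<in>T. v x = a' + G' \<bullet> x" "\<forall>x. x \<notin> T \<longrightarrow> v x = 0"
    using assms by (auto simp: local_space_def P1_def)
  have "\<forall>x\<in>T. u x + t * v x = (a + t * a') + (G + t *\<^sub>R G') \<bullet> x"
    using u v by (auto simp: inner_add_left algebra_simps)
  moreover have "\<forall>x. x \<notin> T \<longrightarrow> u x + t * v x = 0" using u v by simp
  ultimately have "(\<lambda>x. u x + t * v x) \<in> P1 T" unfolding P1_def by blast
  then show ?thesis using False by (simp add: local_space_def)
qed

lemma zero_local_space: "(\<lambda>x. 0) \<in> local_space P \<T> T"
proof -
  have "(\<lambda>x. 0) \<in> IFE P T" unfolding IFE_def by (auto intro!: exI[of _ "{}"])
  moreover have "(\<lambda>x. 0) \<in> P1 T" unfolding P1_def by (auto intro!: exI[of _ 0])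
  ultimately show ?thesis by (simp add: local_space_def)
qed

text \<open>Finitely many point values determine a local function: three points of a small ball on one side
  of the line determine the affine function there, hence all its parameters.\<close>

lemma kink_determined:
  assumes T: "interior T \<noteq> {}" and n: "norm n = 1" and l: "-1 < \<mu>"
  obtains X where "finite X" "\<And>a G. (\<And>x. x \<in> X \<Longrightarrow> kink T n d \<mu> a G x = 0) \<Longrightarrow> kink T n d \<mu> a G = (\<lambda>x. 0)"
proof -
  have n0: "n \<noteq> 0" using n by auto
  have "\<not> interior T \<subseteq> {x. n \<bullet> x = d}"
    using T interior_maximal[of "interior T" "{x. n \<bullet> x = d}"] interior_hyperplane[OF n0, of d] by auto
  then obtain p where p: "p \<in> interior T" "n \<bullet> p \<noteq> d" by auto
  define W where "W = interior T \<inter> {x. if n \<bullet> p > d then n \<bullet> x > d else n \<bullet> x < d}"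
  have "open W" unfolding W_def
    by (cases "n \<bullet> p > d") (auto intro!: open_Int open_halfspace_gt open_halfspace_lt)
  moreover have "p \<in> W" using p by (auto simp: W_def)
  ultimately obtain \<epsilon> where e: "\<epsilon> > 0" "ball p \<epsilon> \<subseteq> W" using open_contains_ball by blast
  define q where "q i = p + (\<epsilon>/2) *\<^sub>R axis i 1" for i :: 2
  have q: "q i \<in> W" for i using e by (intro subsetD[OF e(2)]) (simp add: q_def dist_norm norm_axis_1)
  define X where "X = insert p (range q)"
  have XW: "X \<subseteq> W" using q \<open>p \<in> W\<close> by (auto simp: X_def)
  have "kink T n d \<mu> a G = (\<lambda>x. 0)" if z: "\<And>x. x \<in> X \<Longrightarrow> kink T n d \<mu> a G x = 0" for a G
  proof -
    define H where "H = (if n \<bullet> p > d then G + (\<mu> * (G \<bullet> n)) *\<^sub>R n else G)"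
    define c where "c = (if n \<bullet> p > d then a - \<mu> * (G \<bullet> n) * d else a)"
    have aff: "kink T n d \<mu> a G x = c + H \<bullet> x" if "x \<in> W" for x
      using that interior_subset
      by (auto simp: kink_def H_def c_def W_def inner_add_left algebra_simps split: if_splits)
    have zp: "c + H \<bullet> p = 0" using aff[of p] z[of p] \<open>p \<in> W\<close> by (simp add: X_def)
    have "H $ i = 0" for i
    proof -
      have "c + H \<bullet> q i = 0" using aff[OF q] z[of "q i"] by (simp add: X_def)
      then have "c + H \<bullet> p + \<epsilon> * H $ i / 2 = 0" by (simp add: q_def inner_add_right inner_axis)
      then have "\<epsilon> * H $ i / 2 = 0" using zp by linarith
      then show ?thesis using e(1) by simp
    qed
    then have H0: "H = 0" by (simp add: vec_eq_iff)
    have G0: "G = 0"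
    proof (cases "n \<bullet> p > d")
      case True
      then have "H \<bullet> n = (1 + \<mu>) * (G \<bullet> n)"
        using n by (simp add: H_def inner_add_left algebra_simps dot_square_norm)
      then have "G \<bullet> n = 0" using H0 l by simp
      then show ?thesis using H0 True by (simp add: H_def)
    next
      case False
      then show ?thesis using H0 by (simp add: H_def)
    qed
    then have "a = 0" using zp H0 by (simp add: c_def split: if_splits)
    then show ?thesis using G0 kink_zero by simp
  qed
  then show ?thesis using that[of X] by (simp add: X_def)
qed

section \<open>Edge integrals\<close>

lemma absolutely_integrable_reflect_unit:
  fixes f :: "real \<Rightarrow> real"
  assumes "f absolutely_integrable_on {0..1}"
  shows "(\<lambda>t. f (1 - t)) absolutely_integrable_on {0..1}"
    and "integral {0..1} (\<lambda>t. f (1 - t)) = integral {0..1} f"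
proof -
  have refl: "((\<lambda>t. g (1 - t)) has_integral i) {0..1}" if "(g has_integral i) {0..1}" for g :: "real \<Rightarrow> real" and i
    using has_integral_affinity[of g i 0 1 "-1" 1] that by simp
  have int: "f integrable_on {0..1}" and nint: "(\<lambda>t. norm (f t)) integrable_on {0..1}"
    using assms unfolding absolutely_integrable_on_def by auto
  have "(\<lambda>t. f (1 - t)) integrable_on {0..1}" "(\<lambda>t. norm (f (1 - t))) integrable_on {0..1}"
    using refl[OF integrable_integral[OF int]] refl[OF integrable_integral[OF nint]]
    by (auto simp: integrable_on_def)
  then show "(\<lambda>t. f (1 - t)) absolutely_integrable_on {0..1}"
    unfolding absolutely_integrable_on_def by blast
  show "integral {0..1} (\<lambda>t. f (1 - t)) = integral {0..1} f"
    using refl[OF integrable_integral[OF int]] by (rule integral_unique)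
qed

text \<open>A segment has exactly two parametrizations by ordered end points, and they give the same integral.\<close>

lemma edge_integral_eq:
  assumes e: "e = closed_segment a b"
    and F: "(\<lambda>t. F (linepath a b t)) absolutely_integrable_on {0..1}"
  shows "edge_integral e F = dist a b * integral {0..1} (\<lambda>t. F (linepath a b t))"
proof -
  define I where "I = dist a b * integral {0..1} (\<lambda>t. F (linepath a b t))"
  have all: "I = dist p q * (LINT t:{0..1}|lebesgue. F (linepath p q t))" if "e = closed_segment p q" for p q
  proof -
    have "{p, q} = {a, b}" using that e by (simp add: closed_segment_eq)
    then consider "p = a" "q = b" | "p = b" "q = a" by (auto simp: doubleton_eq_iff)
    then show ?thesis
    proof cases
      case 1
      then show ?thesis using set_lebesgue_integral_eq_integral(2)[OF F] by (simp add: I_def)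
    next
      case 2
      have lp: "linepath p q t = linepath a b (1 - t)" for t using 2 by (simp add: linepath_def)
      have "(LINT t:{0..1}|lebesgue. F (linepath p q t)) = integral {0..1} (\<lambda>t. F (linepath a b t))"
        unfolding lp
        using set_lebesgue_integral_eq_integral(2)[OF absolutely_integrable_reflect_unit(1)[OF F]]
          absolutely_integrable_reflect_unit(2)[OF F] by simp
      then show ?thesis using 2 by (simp add: I_def dist_commute)
    qed
  qed
  have "edge_integral e F = I"
    unfolding edge_integral_def
  proof (rule the_equality)
    show "\<forall>p q. e = closed_segment p q \<longrightarrow> I = dist p q * (LINT t:{0..1}|lebesgue. F (linepath p q t))"
      using all by blast
    fix J assume J: "\<forall>p q. e = closed_segment p q \<longrightarrow> J = dist p q * (LINT t:{0..1}|lebesgue. F (linepath p q t))"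
    show "J = I" using J[rule_format, OF e] all[OF e] by simp
  qed
  then show ?thesis by (simp add: I_def)
qed

lemma absolutely_integrable_linear_unit:
  fixes f :: "real \<Rightarrow> real"
  assumes "f absolutely_integrable_on {0..1}"
  shows "(\<lambda>t. q * (f t - c)) absolutely_integrable_on {0..1}"
    and "integral {0..1} (\<lambda>t. q * (f t - c)) = q * (integral {0..1} f - c)"
proof -
  have c: "(\<lambda>t. c) absolutely_integrable_on {0..1::real}"
    by (intro absolutely_integrable_continuous_real continuous_intros)
  show "(\<lambda>t. q * (f t - c)) absolutely_integrable_on {0..1}"
    using set_integrable_mult_right[of q lebesgue "{0..1}" "\<lambda>t. f t - c"]
      set_integral_diff(1)[OF assms c] by simp
  have "f integrable_on {0..1}" using assms by (rule set_lebesgue_integral_eq_integral(1))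
  then show "integral {0..1} (\<lambda>t. q * (f t - c)) = q * (integral {0..1} f - c)"
    using integral_diff[of f "{0..1}" "\<lambda>t. c"] by (simp add: integrable_const_ivl)
qed

lemma Qb_eq:
  assumes e: "e = closed_segment a b" "a \<noteq> b"
    and F: "(\<lambda>t. F (linepath a b t)) absolutely_integrable_on {0..1}"
  shows "Qb e F = integral {0..1} (\<lambda>t. F (linepath a b t))"
proof -
  define I where "I = integral {0..1} (\<lambda>t. F (linepath a b t))"
  have ei: "edge_integral e (\<lambda>x. (F x - c) * q) = dist a b * (q * (I - c))" for c q
    using edge_integral_eq[OF e(1), of "\<lambda>x. q * (F x - c)"] absolutely_integrable_linear_unit[OF F, of q c]
    by (simp add: I_def mult.commute)
  have "(THE c. \<forall>q. edge_integral e (\<lambda>x. (F x - c) * q) = 0) = I"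
  proof (rule the_equality)
    show "\<forall>q. edge_integral e (\<lambda>x. (F x - I) * q) = 0" by (simp add: ei)
    fix c assume "\<forall>q. edge_integral e (\<lambda>x. (F x - c) * q) = 0"
    then have "dist a b * (1 * (I - c)) = 0" unfolding ei by blast
    then show "c = I" using e(2) by simp
  qed
  then show ?thesis by (simp add: Qb_def I_def)
qed

definition edge_length :: "plane set \<Rightarrow> real" where
  "edge_length e = edge_integral e (\<lambda>x. 1)"

lemma edge_integral_const:
  assumes e: "e = closed_segment a b"
  shows "edge_integral e (\<lambda>x. k) = edge_length e * k" "edge_length e = dist a b"
proof -
  have "(\<lambda>t. k) absolutely_integrable_on {0..1::real}" for k :: real
    by (intro absolutely_integrable_continuous_real continuous_intros)
  then have "edge_integral e (\<lambda>x. k) = dist a b * k" for k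
    using edge_integral_eq[OF e, of "\<lambda>x. k"] by simp
  then show "edge_integral e (\<lambda>x. k) = edge_length e * k" "edge_length e = dist a b"
    by (auto simp: edge_length_def)
qed

lemma edge_integral_weighted_deviation:
  assumes e: "e = closed_segment a b" "a \<noteq> b"
    and F: "(\<lambda>t. F (linepath a b t)) absolutely_integrable_on {0..1}"
  shows "edge_integral e (\<lambda>x. q * (F x - c)) = edge_length e * (q * (Qb e F - c))"
  using edge_integral_eq[OF e(1), of "\<lambda>x. q * (F x - c)"] absolutely_integrable_linear_unit[OF F, of q c]
    Qb_eq[OF e F] edge_integral_const(2)[OF e(1)] by simp

lemma Qb_add_scaled:
  assumes e: "e = closed_segment a b" "a \<noteq> b"
    and F: "(\<lambda>t. F (linepath a b t)) absolutely_integrable_on {0..1}"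
    and H: "(\<lambda>t. H (linepath a b t)) absolutely_integrable_on {0..1}"
  shows "Qb e (\<lambda>x. F x + s * H x) = Qb e F + s * Qb e H"
proof -
  have sH: "(\<lambda>t. s * H (linepath a b t)) absolutely_integrable_on {0..1}"
    using H by simp
  have "Qb e (\<lambda>x. F x + s * H x) = integral {0..1} (\<lambda>t. F (linepath a b t) + s * H (linepath a b t))"
    by (rule Qb_eq[OF e set_integral_add(1)[OF F sH]])
  also have "\<dots> = Qb e F + s * Qb e H"
    unfolding Qb_eq[OF e F] Qb_eq[OF e H]
    using set_lebesgue_integral_eq_integral(1)[OF F] set_lebesgue_integral_eq_integral(1)[OF sH]
    by (simp add: integral_add)
  finally show ?thesis .
qed

section \<open>The form on one element\<close>

definition beta_max :: "interface_problem \<Rightarrow> real" where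
  "beta_max P = max (beta_p P) (beta_m P)"

definition beta_min :: "interface_problem \<Rightarrow> real" where
  "beta_min P = min (beta_p P) (beta_m P)"

text \<open>The two constants of the local estimates depend on the coefficients only, neither on the element nor on
  the position of the cut; this is what makes the threshold for the penalty uniform.\<close>

definition flux_bound :: "interface_problem \<Rightarrow> real" where
  "flux_bound P = beta_max P * (1 + \<bar>slope_jump P\<bar>)"

definition energy_bound :: "interface_problem \<Rightarrow> real" where
  "energy_bound P = beta_min P * min 1 ((1 + slope_jump P)\<^sup>2)"

locale framed_triangle =
  fixes P :: interface_problem and T :: "plane set" and n :: plane and d :: real
  assumes simplex: "2 simplex T" and frame: "frame P T n d"
    and beta_pos: "0 < beta_p P" "0 < beta_m P" and open_m: "open (Omega_m P)"
begin

abbreviation u :: "real \<Rightarrow> plane \<Rightarrow> plane \<Rightarrow> real" where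
  "u \<equiv> kink T n d (slope_jump P)"

abbreviation g :: "plane \<Rightarrow> plane \<Rightarrow> plane" where
  "g \<equiv> kink_grad n d (slope_jump P)"

lemma norm_n: "norm n = 1" using frame by (simp add: frame_def)

lemma n_nz: "n \<noteq> 0" using norm_n by auto

lemma slope_gt: "-1 < slope_jump P" using beta_pos by (simp add: slope_jump_def)

lemma edge_subset:
  assumes "e \<in> tri_edges T"
  shows "e \<subseteq> T" "e \<subseteq> frontier T"
proof -
  show "e \<subseteq> frontier T" using assms triangle_frontier[OF simplex] by auto
  then show "e \<subseteq> T"
    using frontier_subset_closed[OF compact_imp_closed[OF triangle_basic(1)[OF simplex]]] by simp
qed

lemma u_absolutely_integrable:
  assumes "closed_segment p q \<subseteq> T"
  shows "(\<lambda>t. u a G (linepath p q t)) absolutely_integrable_on {0..1}"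
proof (rule absolutely_integrable_continuous_real)
  have "continuous_on {0..1} (\<lambda>t. a + G \<bullet> linepath p q t + slope_jump P * (G \<bullet> n) * max 0 (n \<bullet> linepath p q t - d))"
    by (intro continuous_intros)
  moreover have "linepath p q t \<in> T" if "t \<in> {0..1}" for t
    using that assms linepath_in_path by blast
  ultimately show "continuous_on {0..1} (\<lambda>t. u a G (linepath p q t))"
    by (subst continuous_on_cong[OF refl]) (auto simp: kink_def)
qed

lemma grad_u:
  assumes y: "y \<in> interior T" "n \<bullet> y \<noteq> d"
  shows "grad (u a G) y = g G y"
proof -
  define S where "S = interior T \<inter> {x. if n \<bullet> y > d then n \<bullet> x > d else n \<bullet> x < d}"
  define c where "c = (if n \<bullet> y > d then a - slope_jump P * (G \<bullet> n) * d else a)"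
  have opS: "open S" unfolding S_def
    by (cases "n \<bullet> y > d") (auto intro!: open_Int open_halfspace_gt open_halfspace_lt)
  have yS: "y \<in> S" using y by (auto simp: S_def)
  have eq: "c + g G y \<bullet> x = u a G x" if "x \<in> S" for x
    using that interior_subset
    by (auto simp: kink_def kink_grad_def c_def S_def inner_add_left algebra_simps split: if_splits)
  have "((\<lambda>x. c + g G y \<bullet> x) has_derivative (\<lambda>h. h \<bullet> g G y)) (at y)"
    by (auto intro!: derivative_eq_intros simp: inner_commute)
  then have "(u a G has_derivative (\<lambda>h. h \<bullet> g G y)) (at y)"
    by (rule has_derivative_transform_within_open[OF _ opS yS eq])
  then have D: "GDERIV (u a G) y :> g G y" by (simp add: gderiv_def)
  have "G' = g G y" if "GDERIV (u a G) y :> G'" for G'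
  proof -
    have "(\<lambda>h. h \<bullet> G') = (\<lambda>h. h \<bullet> g G y)"
      using has_derivative_unique[of "u a G" _ y] that D unfolding gderiv_def by blast
    then have "\<forall>h. h \<bullet> G' = h \<bullet> g G y" by (simp add: fun_eq_iff)
    then show ?thesis by (simp only: vector_eq_ldot)
  qed
  then show ?thesis unfolding grad_def using D by blast
qed

text \<open>\<open>S\<close> is the open side of the line that contains \<open>x\<close>; there the gradient is the constant \<open>H\<close>, and the coefficient is constant near \<open>x\<close>
inside the element.\<close>

lemma flux_u:
  assumes x: "x \<in> frontier T" and S: "open S" "x \<in> S" "\<And>y. y \<in> S \<Longrightarrow> n \<bullet> y \<noteq> d" "\<And>y. y \<in> S \<Longrightarrow> g G y = H"
    and b: "\<forall>\<^sub>F y in at x within interior T. beta P y = b"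
  shows "flux P T e (u a G) x = b * (H \<bullet> outer_normal T e)"
proof -
  have "x \<notin> interior T" using x by (simp add: frontier_def)
  moreover have "x \<in> closure (interior T)"
    using x triangle_basic(6)[OF simplex] by (metis DiffD1 closure_closure frontier_def)
  ultimately have nt: "\<not> trivial_limit (at x within interior T)"
    by (simp add: trivial_limit_within closure_def)
  have "\<forall>\<^sub>F y in at x within interior T. y \<in> S"
    using S(1,2) eventually_at_topological by blast
  moreover have "\<forall>\<^sub>F y in at x within interior T. y \<in> interior T"
    by (simp add: eventually_at_filter)
  ultimately have "\<forall>\<^sub>F y in at x within interior T.
      beta P y * (grad (u a G) y \<bullet> outer_normal T e) = b * (H \<bullet> outer_normal T e)"
    using b by eventually_elim (use S grad_u in auto)
  then show ?thesis unfolding flux_def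
    by (intro tendsto_Lim[OF nt] tendsto_eventually)
qed

lemma beta_min_pos: "0 < beta_min P" using beta_pos by (simp add: beta_min_def)

lemma beta_bounds: "beta_min P \<le> beta P x" "beta P x \<le> beta_max P"
  by (auto simp: beta_min_def beta_max_def beta_def)

text \<open>Apart from the finitely many points of the line on the edge, the flux is one of two linear functions of \<open>G\<close>, depending on
the side; so its mean is linear in \<open>G\<close>, with a bound that holds for every position of the crossing point.\<close>

lemma mean_flux:
  assumes e: "e \<in> tri_edges T"
  shows "\<exists>c. norm c \<le> flux_bound P \<and> (\<forall>a G. Qb e (flux P T e (u a G)) = c \<bullet> G)"
proof -
  define \<nu> where "\<nu> = outer_normal T e"
  define \<mu> where "\<mu> = slope_jump P"
  have nu: "norm \<nu> = 1" unfolding \<nu>_def using norm_outer_normal[OF simplex e] .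
  obtain p q where pq: "p \<noteq> q" "e = closed_segment p q" by (rule tri_edge_segment[OF simplex e])
  obtain b1 where b1: "b1 \<in> {beta_p P, beta_m P}"
      "\<forall>x\<in>frontier T. n \<bullet> x > d \<longrightarrow> (\<forall>\<^sub>F y in at x within interior T. beta P y = b1)"
    using frame unfolding frame_def by blast
  obtain b2 where b2: "b2 \<in> {beta_p P, beta_m P}"
      "\<forall>x\<in>frontier T. n \<bullet> x < d \<longrightarrow> (\<forall>\<^sub>F y in at x within interior T. beta P y = b2)"
    using frame unfolding frame_def by blast
  have bb: "0 \<le> b1" "b1 \<le> beta_max P" "0 \<le> b2" "b2 \<le> beta_max P"
    using b1(1) b2(1) beta_pos by (auto simp: beta_max_def)
  define c1 where "c1 = b1 *\<^sub>R (\<nu> + (\<mu> * (n \<bullet> \<nu>)) *\<^sub>R n)"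
  define c2 where "c2 = b2 *\<^sub>R \<nu>"
  define M where "M = beta_max P * (1 + \<bar>\<mu>\<bar>)"
  have nc1: "norm c1 \<le> M"
  proof -
    have "\<bar>n \<bullet> \<nu>\<bar> \<le> 1" using Cauchy_Schwarz_ineq2[of n \<nu>] nu norm_n by simp
    then have "\<bar>\<mu>\<bar> * \<bar>n \<bullet> \<nu>\<bar> \<le> \<bar>\<mu>\<bar>" by (simp add: mult_left_le)
    then have "norm (\<nu> + (\<mu> * (n \<bullet> \<nu>)) *\<^sub>R n) \<le> 1 + \<bar>\<mu>\<bar>"
      using norm_triangle_ineq[of \<nu> "(\<mu> * (n \<bullet> \<nu>)) *\<^sub>R n"] nu norm_n by (simp add: abs_mult)
    then show ?thesis unfolding c1_def M_def using bb by (simp add: mult_mono)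
  qed
  have nc2: "norm c2 \<le> M"
    unfolding c2_def M_def using bb nu mult_mono[of b2 "beta_max P" 1 "1 + \<bar>\<mu>\<bar>"] by simp
  define c where "c t = (if n \<bullet> linepath p q t > d then c1 else c2)" for t
  define N where "N = {t \<in> {0..1}. n \<bullet> linepath p q t = d}"
  have finN: "finite N"
  proof -
    have "linepath p q ` N \<subseteq> frontier T \<inter> {x. n \<bullet> x = d}"
      using edge_subset(2)[OF e] pq(2) linepath_in_path[of _ p q] by (auto simp: N_def)
    moreover have "finite (frontier T \<inter> {x. n \<bullet> x = d})" using frame by (simp add: frame_def)
    ultimately have "finite (linepath p q ` N)" by (rule finite_subset)
    moreover have "inj_on (linepath p q) N" 
      by (rule inj_on_subset[OF inj_on_linepath[OF pq(1)]]) (auto simp: N_def)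
    ultimately show ?thesis by (rule finite_imageD)
  qed
  have fl: "flux P T e (u a G) (linepath p q t) = c t \<bullet> G" if t: "t \<in> {0..1} - N" for t a G
  proof -
    define x where "x = linepath p q t"
    have "x \<in> e" using t pq(2) by (auto simp: x_def linepath_in_path)
    then have xf: "x \<in> frontier T" using edge_subset(2)[OF e] by blast
    have "n \<bullet> x \<noteq> d" using t by (auto simp: N_def x_def)
    then consider "n \<bullet> x > d" | "n \<bullet> x < d" by linarith
    then have "flux P T e (u a G) x = c t \<bullet> G"
    proof cases
      case 1
      have "flux P T e (u a G) x = b1 * ((G + (\<mu> * (G \<bullet> n)) *\<^sub>R n) \<bullet> outer_normal T e)"
        using 1 b1(2) xf
        by (intro flux_u[OF xf open_halfspace_gt[of d n]]) (auto simp: kink_grad_def \<mu>_def)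
      also have "\<dots> = c t \<bullet> G"
        using 1 by (simp add: c_def x_def[symmetric] c1_def \<nu>_def[symmetric] inner_add_left inner_add_right inner_commute)
      finally show ?thesis .
    next
      case 2
      have "flux P T e (u a G) x = b2 * (G \<bullet> outer_normal T e)"
        using 2 b2(2) xf
        by (intro flux_u[OF xf open_halfspace_lt[of n d]]) (auto simp: kink_grad_def)
      also have "\<dots> = c t \<bullet> G"
        using 2 by (simp add: c_def x_def[symmetric] c2_def \<nu>_def[symmetric] inner_commute)
      finally show ?thesis .
    qed
    then show ?thesis by (simp add: x_def)
  qed
  have cb: "norm (c t) \<le> M" for t using nc1 nc2 by (simp add: c_def)
  have cmeas: "c \<in> borel_measurable (lebesgue_on {0..1})"
  proof -
    have "open {t. n \<bullet> linepath p q t > d}" by (intro open_Collect_less continuous_intros)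
    then have "c \<in> borel_measurable borel" unfolding c_def
      by (intro measurable_If) (auto intro: borel_open)
    then have "c \<in> borel_measurable lebesgue" by (intro measurable_completion) simp
    then show ?thesis by (rule measurable_restrict_space1)
  qed
  have cint: "c absolutely_integrable_on {0..1}"
    by (rule measurable_bounded_by_integrable_imp_absolutely_integrable[OF cmeas, of "\<lambda>t. M"]) (use cb in auto)
  then have ci: "c integrable_on {0..1}" by (rule set_lebesgue_integral_eq_integral(1))
  define C where "C = integral {0..1} c"
  have "norm C \<le> integral {0..1} (\<lambda>t::real. M)"
    unfolding C_def by (intro integral_norm_bound_integral[OF ci]) (use cb in auto)
  then have nC: "norm C \<le> M" by simp
  have "Qb e (flux P T e (u a G)) = C \<bullet> G" for a G
  proof -
    have neg: "negligible N" using finN by (rule negligible_finite)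
    have "(\<lambda>t. c t \<bullet> G) absolutely_integrable_on {0..1}"
      using absolutely_integrable_linear[OF cint bounded_linear_inner_left[of G]] by (simp add: o_def)
    then have ai: "(\<lambda>t. flux P T e (u a G) (linepath p q t)) absolutely_integrable_on {0..1}"
      by (rule absolutely_integrable_spike[OF _ neg]) (use fl in auto)
    have "Qb e (flux P T e (u a G)) = integral {0..1} (\<lambda>t. flux P T e (u a G) (linepath p q t))"
      by (rule Qb_eq[OF pq(2,1) ai])
    also have "\<dots> = integral {0..1} (\<lambda>t. c t \<bullet> G)"
      by (rule integral_spike[OF neg]) (use fl in auto)
    also have "\<dots> = C \<bullet> G"
      using integral_linear[OF ci bounded_linear_inner_left[of G]] by (simp add: o_def C_def)
    finally show ?thesis .
  qed
  then show ?thesis using nC unfolding M_def \<mu>_def flux_bound_def[symmetric] by blast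
qed

text \<open>The gradients on the two sides have the same tangential component, and the normal components differ by
the factor \<open>1 + \<mu>\<close>.\<close>

lemma g_bounds:
  shows "norm (g G x) \<le> (1 + \<bar>slope_jump P\<bar>) * norm G"
    and "min 1 ((1 + slope_jump P)\<^sup>2) * (norm G)\<^sup>2 \<le> g G x \<bullet> g G x"
proof -
  define \<mu> where "\<mu> = slope_jump P"
  have nG: "\<bar>G \<bullet> n\<bar> \<le> norm G" using Cauchy_Schwarz_ineq2[of G n] norm_n by simp
  have nn: "n \<bullet> n = 1" using norm_n by (simp add: norm_eq_1)
  have "norm (G + (\<mu> * (G \<bullet> n)) *\<^sub>R n) \<le> norm G + \<bar>\<mu>\<bar> * \<bar>G \<bullet> n\<bar>"
    using norm_triangle_ineq[of G "(\<mu> * (G \<bullet> n)) *\<^sub>R n"] norm_n by (simp add: abs_mult)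
  also have "\<dots> \<le> norm G + \<bar>\<mu>\<bar> * norm G" using nG by (simp add: mult_left_mono)
  finally show "norm (g G x) \<le> (1 + \<bar>slope_jump P\<bar>) * norm G"
    unfolding kink_grad_def \<mu>_def by (auto simp: algebra_simps)
  define s where "s = (G \<bullet> n)\<^sup>2"
  have s: "0 \<le> s" "s \<le> (norm G)\<^sup>2" using nG unfolding s_def by (auto simp: abs_le_square_iff[symmetric])
  have e1: "(G + (\<mu> * (G \<bullet> n)) *\<^sub>R n) \<bullet> (G + (\<mu> * (G \<bullet> n)) *\<^sub>R n) = (norm G)\<^sup>2 - s + (1 + \<mu>)\<^sup>2 * s"
    unfolding power2_norm_eq_inner s_def
    by (simp add: inner_add_left inner_add_right nn inner_commute[of n G] power2_eq_square) algebra
  define k where "k = min 1 ((1 + \<mu>)\<^sup>2)"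
  have k: "k \<le> 1" "k \<le> (1 + \<mu>)\<^sup>2" by (auto simp: k_def)
  have "k * (norm G)\<^sup>2 = k * ((norm G)\<^sup>2 - s) + k * s" by (simp add: algebra_simps)
  also have "\<dots> \<le> 1 * ((norm G)\<^sup>2 - s) + (1 + \<mu>)\<^sup>2 * s"
    using k s by (intro add_mono mult_right_mono) auto
  finally have 1: "k * (norm G)\<^sup>2 \<le> (G + (\<mu> * (G \<bullet> n)) *\<^sub>R n) \<bullet> (G + (\<mu> * (G \<bullet> n)) *\<^sub>R n)"
    using e1 by simp
  have 2: "k * (norm G)\<^sup>2 \<le> G \<bullet> G"
    using mult_right_mono[OF k(1), of "(norm G)\<^sup>2"] by (simp add: power2_norm_eq_inner)
  show "min 1 ((1 + slope_jump P)\<^sup>2) * (norm G)\<^sup>2 \<le> g G x \<bullet> g G x"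
    using 1 2 unfolding kink_grad_def \<mu>_def[symmetric] k_def[symmetric] by auto
qed

lemma T_measurable: "T \<in> lmeasurable" "T \<in> sets lebesgue"
  using triangle_basic(1)[OF simplex] lmeasurable_compact by (auto intro: fmeasurableD)

lemma energy_integrable:
  "(\<lambda>x. beta P x * (g G x \<bullet> g G' x)) absolutely_integrable_on T"
proof -
  have op: "open {x. n \<bullet> x > d}" by (rule open_halfspace_gt)
  have gm: "g G \<in> borel_measurable borel" for G
    unfolding kink_grad_def using op
    by (intro measurable_If) (auto intro: borel_open)
  have "beta P \<in> borel_measurable borel"
    unfolding beta_def using open_m
    by (intro measurable_If) (auto intro: borel_open)
  then have "(\<lambda>x. beta P x * (g G x \<bullet> g G' x)) \<in> borel_measurable borel"
    using gm[of G] gm[of G'] by measurable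
  then have "(\<lambda>x. beta P x * (g G x \<bullet> g G' x)) \<in> borel_measurable lebesgue"
    by (intro measurable_completion) simp
  then have m: "(\<lambda>x. beta P x * (g G x \<bullet> g G' x)) \<in> borel_measurable (lebesgue_on T)"
    by (rule measurable_restrict_space1)
  define K where "K = beta_max P * (((1 + \<bar>slope_jump P\<bar>) * norm G) * ((1 + \<bar>slope_jump P\<bar>) * norm G'))"
  have "norm (beta P x * (g G x \<bullet> g G' x)) \<le> K" for x
  proof -
    have "\<bar>g G x \<bullet> g G' x\<bar> \<le> ((1 + \<bar>slope_jump P\<bar>) * norm G) * ((1 + \<bar>slope_jump P\<bar>) * norm G')"
      by (rule order_trans[OF Cauchy_Schwarz_ineq2 mult_mono]) (auto intro!: g_bounds)
    moreover have "\<bar>beta P x\<bar> \<le> beta_max P" using beta_bounds[of x] beta_min_pos by auto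
    ultimately show ?thesis unfolding K_def real_norm_def abs_mult by (intro mult_mono) auto
  qed
  then show ?thesis
    by (intro measurable_bounded_by_integrable_imp_absolutely_integrable[OF m T_measurable(2), of "\<lambda>x. K"])
      (auto intro!: integrable_on_const T_measurable)
qed

text \<open>The gradient is only known off the line and in the interior; the rest of the element is a null set.\<close>

lemma energy_eq:
  "(LINT x:T|lebesgue. beta P x * (grad (u a G) x \<bullet> grad (u a' G') x)) =
   integral T (\<lambda>x. beta P x * (g G x \<bullet> g G' x))"
proof -
  define N where "N = frontier T \<union> {x. n \<bullet> x = d}"
  have neg: "negligible N" unfolding N_def
    using negligible_convex_frontier[OF triangle_basic(2)[OF simplex]] negligible_hyperplane[of n d] n_nz
    by (simp add: negligible_Un)
  have eq: "beta P x * (grad (u a G) x \<bullet> grad (u a' G') x) = beta P x * (g G x \<bullet> g G' x)" if x: "x \<in> T - N" for x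
  proof -
    have "x \<in> interior T" using x closure_subset by (auto simp: N_def frontier_def)
    then show ?thesis using x grad_u by (simp add: N_def)
  qed
  have "(\<lambda>x. beta P x * (grad (u a G) x \<bullet> grad (u a' G') x)) absolutely_integrable_on T"
    by (rule absolutely_integrable_spike[OF energy_integrable neg]) (use eq in auto)
  then have "(LINT x:T|lebesgue. beta P x * (grad (u a G) x \<bullet> grad (u a' G') x)) =
      integral T (\<lambda>x. beta P x * (grad (u a G) x \<bullet> grad (u a' G') x))"
    by (rule set_lebesgue_integral_eq_integral(2))
  also have "\<dots> = integral T (\<lambda>x. beta P x * (g G x \<bullet> g G' x))"
    by (rule integral_spike[OF neg]) (rule eq[symmetric])
  finally show ?thesis .
qed

lemma energy_bound_pos: "0 < energy_bound P"
  using beta_min_pos slope_gt by (auto simp: energy_bound_def)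

lemma energy_coercive:
  "energy_bound P * measure lebesgue T * (norm G)\<^sup>2 \<le> integral T (\<lambda>x. beta P x * (g G x \<bullet> g G x))"
proof -
  have c: "(\<lambda>x. energy_bound P * (norm G)\<^sup>2) integrable_on T" by (rule integrable_on_const[OF T_measurable(1)])
  have "integral T (\<lambda>x. K) = measure lebesgue T * K" for K :: real
    using integral_mult_left[of T "\<lambda>x. 1" K] lmeasure_integral[OF T_measurable(1)] by simp
  then have "energy_bound P * measure lebesgue T * (norm G)\<^sup>2 = integral T (\<lambda>x. energy_bound P * (norm G)\<^sup>2)"
    by simp
  also have "\<dots> \<le> integral T (\<lambda>x. beta P x * (g G x \<bullet> g G x))"
  proof (rule integral_le[OF c set_lebesgue_integral_eq_integral(1)[OF energy_integrable]])
    fix x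
    show "energy_bound P * (norm G)\<^sup>2 \<le> beta P x * (g G x \<bullet> g G x)"
      unfolding energy_bound_def mult.assoc
      using beta_bounds(1)[of x] g_bounds(2)[of G x] beta_min_pos slope_gt by (intro mult_mono) auto
  qed
  finally show ?thesis .
qed

end

definition element_form :: "interface_problem \<Rightarrow> real \<Rightarrow> real \<Rightarrow> plane set \<Rightarrow>
    (plane \<Rightarrow> real) \<Rightarrow> (plane set \<Rightarrow> real) \<Rightarrow> (plane \<Rightarrow> real) \<Rightarrow> (plane set \<Rightarrow> real) \<Rightarrow> real" where
  "element_form P \<rho> h T w wb v vb =
     (LINT x:T|lebesgue. beta P x * (grad w x \<bullet> grad v x))
     - (\<Sum>e\<in>tri_edges T. edge_integral e (\<lambda>x. Qb e (flux P T e w) * (v x - vb e)))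
     - (\<Sum>e\<in>tri_edges T. edge_integral e (\<lambda>x. Qb e (flux P T e v) * (w x - wb e)))
     + \<rho> * inverse h * (\<Sum>e\<in>tri_edges T. edge_integral e (\<lambda>x. (Qb e w - wb e) * (Qb e v - vb e)))"

lemma iwg_form_sum:
  "iwg_form P \<T> \<rho> w v =
     (\<Sum>T\<in>\<T>. element_form P \<rho> (mesh_size \<T>) T (fst w T) (snd w) (fst v T) (snd v))"
  by (simp add: iwg_form_def element_form_def case_prod_beta)

lemma element_form_sym: "element_form P \<rho> h T w wb v vb = element_form P \<rho> h T v vb w wb"
  by (simp add: element_form_def inner_commute mult.commute)

context framed_triangle
begin

definition mean_flux_vector :: "plane set \<Rightarrow> plane" where
  "mean_flux_vector e =
     (SOME c. norm c \<le> flux_bound P \<and> (\<forall>a G. Qb e (flux P T e (u a G)) = c \<bullet> G))"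

lemma mean_flux_vector:
  assumes "e \<in> tri_edges T"
  shows "norm (mean_flux_vector e) \<le> flux_bound P" "Qb e (flux P T e (u a G)) = mean_flux_vector e \<bullet> G"
  using someI_ex[OF mean_flux[OF assms]] unfolding mean_flux_vector_def by blast+

lemma edge_facts:
  assumes e: "e \<in> tri_edges T"
  shows "edge_integral e (\<lambda>x. q * (u a G x - c)) = edge_length e * (q * (Qb e (u a G) - c))"
    and "edge_integral e (\<lambda>x. k) = edge_length e * k"
    and "0 < edge_length e" "edge_length e \<le> diameter T"
    and "Qb e (\<lambda>x. u a G x + t * u a' G' x) = Qb e (u a G) + t * Qb e (u a' G')"
    and "Qb e (u a 0) = a"
proof -
  obtain p q where pq: "p \<noteq> q" "e = closed_segment p q" by (rule tri_edge_segment[OF simplex e])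
  have sub: "closed_segment p q \<subseteq> T" using edge_subset(1)[OF e] pq(2) by simp
  show "edge_integral e (\<lambda>x. q * (u a G x - c)) = edge_length e * (q * (Qb e (u a G) - c))" for q
    by (rule edge_integral_weighted_deviation[OF pq(2,1) u_absolutely_integrable[OF sub]])
  show "edge_integral e (\<lambda>x. k) = edge_length e * k" by (rule edge_integral_const(1)[OF pq(2)])
  show "0 < edge_length e" using edge_integral_const(2)[OF pq(2)] pq(1) by simp
  have "p \<in> T" "q \<in> T" using sub by auto
  then show "edge_length e \<le> diameter T"
    using edge_integral_const(2)[OF pq(2)] diameter_bounded_bound[of T p q]
      triangle_basic(1)[OF simplex] compact_imp_bounded by auto
  show "Qb e (\<lambda>x. u a G x + t * u a' G' x) = Qb e (u a G) + t * Qb e (u a' G')"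
    by (rule Qb_add_scaled[OF pq(2,1) u_absolutely_integrable[OF sub] u_absolutely_integrable[OF sub]])
  have "u a 0 (linepath p q t) = a" if "t \<in> {0..1}" for t
    using that sub linepath_in_path[of t p q] by (auto simp: kink_def)
  then have "integral {0..1} (\<lambda>t. u a 0 (linepath p q t)) = integral {0..1} (\<lambda>t::real. a)"
    by (intro integral_cong) auto
  then show "Qb e (u a 0) = a"
    using Qb_eq[OF pq(2,1) u_absolutely_integrable[OF sub]] by simp
qed

lemma element_form_u:
  "element_form P \<rho> h T (u a G) b (u a' G') b' =
     integral T (\<lambda>x. beta P x * (g G x \<bullet> g G' x))
     - (\<Sum>e\<in>tri_edges T. edge_length e * ((mean_flux_vector e \<bullet> G) * (Qb e (u a' G') - b' e)))
     - (\<Sum>e\<in>tri_edges T. edge_length e * ((mean_flux_vector e \<bullet> G') * (Qb e (u a G) - b e)))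
     + \<rho> * inverse h * (\<Sum>e\<in>tri_edges T. edge_length e * ((Qb e (u a G) - b e) * (Qb e (u a' G') - b' e)))"
proof -
  have "(\<Sum>e\<in>tri_edges T. edge_integral e (\<lambda>x. Qb e (flux P T e (u a G)) * (u a' G' x - b' e))) =
     (\<Sum>e\<in>tri_edges T. edge_length e * ((mean_flux_vector e \<bullet> G) * (Qb e (u a' G') - b' e)))" for a G a' G' b'
    by (intro sum.cong refl) (simp add: edge_facts(1) mean_flux_vector(2))
  moreover have "(\<Sum>e\<in>tri_edges T. edge_integral e (\<lambda>x. (Qb e (u a G) - b e) * (Qb e (u a' G') - b' e))) =
     (\<Sum>e\<in>tri_edges T. edge_length e * ((Qb e (u a G) - b e) * (Qb e (u a' G') - b' e)))"
    by (intro sum.cong refl) (simp add: edge_facts(2))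
  ultimately show ?thesis unfolding element_form_def energy_eq by simp
qed

lemma energy_add_scaled:
  "integral T (\<lambda>x. beta P x * (g (G + t *\<^sub>R H) x \<bullet> g G' x)) =
     integral T (\<lambda>x. beta P x * (g G x \<bullet> g G' x)) + t * integral T (\<lambda>x. beta P x * (g H x \<bullet> g G' x))"
proof -
  note int = set_lebesgue_integral_eq_integral(1)[OF energy_integrable]
  have "(\<lambda>x. t * (beta P x * (g H x \<bullet> g G' x))) integrable_on T"
    using integrable_on_cmult_left[OF int[of H G'], of t] by simp
  then have "integral T (\<lambda>x. beta P x * (g G x \<bullet> g G' x) + t * (beta P x * (g H x \<bullet> g G' x))) =
      integral T (\<lambda>x. beta P x * (g G x \<bullet> g G' x)) + t * integral T (\<lambda>x. beta P x * (g H x \<bullet> g G' x))"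
    using integral_add[OF int[of G G']] by simp
  then show ?thesis
    by (simp add: kink_grad_comb inner_add_left algebra_simps)
qed

lemma element_form_add_scaled:
  assumes "w \<in> kinks T n d (slope_jump P)" "w' \<in> kinks T n d (slope_jump P)" "v \<in> kinks T n d (slope_jump P)"
  shows "element_form P \<rho> h T (\<lambda>x. w x + t * w' x) (\<lambda>e. b e + t * b' e) v c =
    element_form P \<rho> h T w b v c + t * element_form P \<rho> h T w' b' v c"
proof -
  obtain a G a1 G1 a2 G2 where w: "w = u a G" "w' = u a1 G1" "v = u a2 G2"
    using assms unfolding kinks_def by blast
  have Q: "Qb e (u (a + t * a1) (G + t *\<^sub>R G1)) = Qb e (u a G) + t * Qb e (u a1 G1)" if "e \<in> tri_edges T" for e
    using edge_facts(5)[OF that, of a G t a1 G1] unfolding kink_comb .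
  define m where "m e = Qb e (u a G)" for e
  define m1 where "m1 e = Qb e (u a1 G1)" for e
  define m2 where "m2 e = Qb e (u a2 G2)" for e
  have s1: "(\<Sum>e\<in>tri_edges T. edge_length e * ((mean_flux_vector e \<bullet> (G + t *\<^sub>R G1)) * (m2 e - c e))) =
      (\<Sum>e\<in>tri_edges T. edge_length e * ((mean_flux_vector e \<bullet> G) * (m2 e - c e)))
      + t * (\<Sum>e\<in>tri_edges T. edge_length e * ((mean_flux_vector e \<bullet> G1) * (m2 e - c e)))"
    unfolding sum_distrib_left sum.distrib[symmetric]
    by (intro sum.cong refl) (simp add: inner_add_right algebra_simps)
  have s2: "(\<Sum>e\<in>tri_edges T. edge_length e * (k e * (Qb e (u (a + t * a1) (G + t *\<^sub>R G1)) - (b e + t * b' e)))) =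
      (\<Sum>e\<in>tri_edges T. edge_length e * (k e * (m e - b e)))
      + t * (\<Sum>e\<in>tri_edges T. edge_length e * (k e * (m1 e - b' e)))" for k
    unfolding sum_distrib_left sum.distrib[symmetric]
    by (intro sum.cong refl) (subst Q, assumption, simp add: m_def m1_def algebra_simps)
  note s3 = s2[of "\<lambda>e. m2 e - c e"]
  show ?thesis
    unfolding w kink_comb element_form_u energy_add_scaled m_def[symmetric] m1_def[symmetric] m2_def[symmetric]
    unfolding s1 s2 mult.commute[of "_ - (b _ + t * b' _)"] mult.commute[of "m _ - b _"] mult.commute[of "m1 _ - b' _"] s3
    by (simp add: algebra_simps)
qed

lemma area_pos: "0 < measure lebesgue T"
proof -
  obtain p where "p \<in> interior T" using triangle_basic(4)[OF simplex] by blast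
  then obtain \<epsilon> where p: "\<epsilon> > 0" "cball p \<epsilon> \<subseteq> interior T"
    using open_contains_cball[of "interior T"] by auto
  then have "cball p \<epsilon> \<subseteq> T" using interior_subset by blast
  then have "measure lborel (cball p \<epsilon>) \<le> measure lebesgue T"
    using measure_mono_fmeasurable[OF _ _ T_measurable(1), of "cball p \<epsilon>"] by simp
  then show ?thesis using content_cball_gt_0_iff[of p \<epsilon>] p(1) by linarith
qed

text \<open>Both flux terms together are twice the sum of \<open>c\<^sub>e j\<^sub>e\<close> over the edges, weighted by their lengths, with the mean flux \<open>c\<^sub>e\<close> and the deviation \<open>j\<^sub>e\<close> of
the mean of the function from the edge value.  Young's inequality, weighted by \<open>\<rho>/h\<close>, lets half of the penalty
absorb the part with \<open>j\<^sub>e\<close>; the part with \<open>c\<^sub>e\<close> is bounded by half of the energy if \<open>\<rho>\<close> is large.  The factor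
\<open>32 = 8 \<cdot> 2 \<cdot> 2\<close> comes from the crude count of at most 8 edges, from Young's inequality and from taking half
of the energy.\<close>

lemma element_form_coercive:
  assumes h: "0 < h" "diameter T \<le> h" and \<rho>: "0 < \<rho>"
    and large: "32 * h\<^sup>2 * (flux_bound P)\<^sup>2 \<le> \<rho> * (energy_bound P * measure lebesgue T)"
  shows "energy_bound P * measure lebesgue T / 2 * (norm G)\<^sup>2
      + \<rho> / (2 * h) * (\<Sum>e\<in>tri_edges T. edge_length e * (Qb e (u a G) - b e)\<^sup>2)
    \<le> element_form P \<rho> h T (u a G) b (u a G) b"
proof -
  define j where "j e = Qb e (u a G) - b e" for e
  define c where "c e = mean_flux_vector e \<bullet> G" for e
  define E where "E = energy_bound P * measure lebesgue T"
  define M where "M = flux_bound P"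
  define I where "I = integral T (\<lambda>x. beta P x * (g G x \<bullet> g G x))"
  define J where "J = (\<Sum>e\<in>tri_edges T. edge_length e * (j e)\<^sup>2)"
  have I: "E * (norm G)\<^sup>2 \<le> I" unfolding E_def I_def by (rule energy_coercive)
  have cM: "(c e)\<^sup>2 \<le> M\<^sup>2 * (norm G)\<^sup>2" if e: "e \<in> tri_edges T" for e
  proof -
    have "\<bar>c e\<bar> \<le> norm (mean_flux_vector e) * norm G" unfolding c_def by (rule Cauchy_Schwarz_ineq2)
    also have "\<dots> \<le> M * norm G" unfolding M_def using mean_flux_vector(1)[OF e] by (simp add: mult_right_mono)
    finally have "\<bar>c e\<bar>\<^sup>2 \<le> (M * norm G)\<^sup>2" by (rule power_mono) simp
    then show ?thesis by (simp add: power_mult_distrib)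
  qed
  have young: "2 * (edge_length e * (c e * j e)) \<le> 2 * h\<^sup>2 / \<rho> * (M\<^sup>2 * (norm G)\<^sup>2) + \<rho> / (2 * h) * (edge_length e * (j e)\<^sup>2)"
    if e: "e \<in> tri_edges T" for e
  proof -
    have "0 \<le> (2 * h * c e - \<rho> * j e)\<^sup>2 / (2 * h * \<rho>)" using h \<rho> by simp
    also have "\<dots> = 2 * h / \<rho> * (c e)\<^sup>2 + \<rho> / (2 * h) * (j e)\<^sup>2 - 2 * (c e * j e)"
      using h(1) \<rho> by (simp add: field_simps power2_eq_square)
    finally have "2 * (c e * j e) \<le> 2 * h / \<rho> * (c e)\<^sup>2 + \<rho> / (2 * h) * (j e)\<^sup>2" by simp
    then have "edge_length e * (2 * (c e * j e)) \<le> edge_length e * (2 * h / \<rho> * (c e)\<^sup>2 + \<rho> / (2 * h) * (j e)\<^sup>2)"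
      using edge_facts(3)[OF e] by (intro mult_left_mono) auto
    then have "2 * (edge_length e * (c e * j e)) \<le> edge_length e * (2 * h / \<rho> * (c e)\<^sup>2) + \<rho> / (2 * h) * (edge_length e * (j e)\<^sup>2)"
      by (simp add: algebra_simps)
    moreover have "edge_length e * (2 * h / \<rho> * (c e)\<^sup>2) \<le> h * (2 * h / \<rho> * (M\<^sup>2 * (norm G)\<^sup>2))"
      using edge_facts(3,4)[OF e] h \<rho> cM[OF e] by (intro mult_mono mult_left_mono) auto
    ultimately show ?thesis by (simp add: power2_eq_square)
  qed
  have "2 * (\<Sum>e\<in>tri_edges T. edge_length e * (c e * j e)) \<le>
      (\<Sum>e\<in>tri_edges T. 2 * h\<^sup>2 / \<rho> * (M\<^sup>2 * (norm G)\<^sup>2) + \<rho> / (2 * h) * (edge_length e * (j e)\<^sup>2))"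
    unfolding sum_distrib_left by (intro sum_mono young)
  also have "\<dots> = real (card (tri_edges T)) * (2 * h\<^sup>2 / \<rho> * (M\<^sup>2 * (norm G)\<^sup>2)) + \<rho> / (2 * h) * J"
    by (simp add: sum.distrib sum_distrib_left J_def)
  also have "\<dots> \<le> 8 * (2 * h\<^sup>2 / \<rho> * (M\<^sup>2 * (norm G)\<^sup>2)) + \<rho> / (2 * h) * J"
    using card_tri_edges(2)[OF simplex] \<rho> by (intro add_right_mono mult_right_mono) auto
  also have "8 * (2 * h\<^sup>2 / \<rho> * (M\<^sup>2 * (norm G)\<^sup>2)) \<le> E / 2 * (norm G)\<^sup>2"
  proof -
    have "16 * h\<^sup>2 * M\<^sup>2 \<le> \<rho> * (E / 2)" using large by (simp add: E_def M_def)
    then have "16 * h\<^sup>2 * M\<^sup>2 / \<rho> \<le> E / 2" using \<rho> by (simp add: field_simps)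
    then have "16 * h\<^sup>2 * M\<^sup>2 / \<rho> * (norm G)\<^sup>2 \<le> E / 2 * (norm G)\<^sup>2" by (rule mult_right_mono) simp
    then show ?thesis by (simp add: algebra_simps)
  qed
  finally have S: "2 * (\<Sum>e\<in>tri_edges T. edge_length e * (c e * j e)) \<le> E / 2 * (norm G)\<^sup>2 + \<rho> / (2 * h) * J" by simp
  have "\<rho> * inverse h * J = 2 * (\<rho> / (2 * h) * J)" using h by (simp add: field_simps)
  moreover have "element_form P \<rho> h T (u a G) b (u a G) b =
      I - 2 * (\<Sum>e\<in>tri_edges T. edge_length e * (c e * j e)) + \<rho> * inverse h * J"
    unfolding element_form_u I_def J_def c_def j_def by (simp add: power2_eq_square)
  moreover have "E * (norm G)\<^sup>2 = E / 2 * (norm G)\<^sup>2 + E / 2 * (norm G)\<^sup>2" by simp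
  ultimately show ?thesis using I S unfolding E_def[symmetric] j_def[symmetric] J_def[symmetric] by linarith
qed

lemma element_form_nonneg_zero:
  assumes h: "0 < h" "diameter T \<le> h" and \<rho>: "0 < \<rho>"
    and large: "32 * h\<^sup>2 * (flux_bound P)\<^sup>2 \<le> \<rho> * (energy_bound P * measure lebesgue T)"
    and w: "w \<in> kinks T n d (slope_jump P)"
  shows "0 \<le> element_form P \<rho> h T w b w b"
    and "element_form P \<rho> h T w b w b = 0 \<Longrightarrow> \<exists>a. w = u a 0 \<and> (\<forall>e\<in>tri_edges T. b e = a)"
proof -
  obtain a G where wu: "w = u a G" using w by (auto simp: kinks_def)
  define X where "X = energy_bound P * measure lebesgue T / 2 * (norm G)\<^sup>2"
  define J where "J = (\<Sum>e\<in>tri_edges T. edge_length e * (Qb e (u a G) - b e)\<^sup>2)"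
  have le: "X + \<rho> / (2 * h) * J \<le> element_form P \<rho> h T w b w b"
    unfolding wu X_def J_def by (rule element_form_coercive[OF h \<rho> large])
  have pos: "0 < energy_bound P * measure lebesgue T / 2" using energy_bound_pos area_pos by simp
  then have X0: "0 \<le> X" by (simp add: X_def)
  have t0: "0 \<le> edge_length e * (Qb e (u a G) - b e)\<^sup>2" if "e \<in> tri_edges T" for e
    using edge_facts(3)[OF that] by simp
  then have J0: "0 \<le> J" unfolding J_def by (intro sum_nonneg)
  have r: "0 < \<rho> / (2 * h)" using h \<rho> by simp
  then have "0 \<le> \<rho> / (2 * h) * J" using J0 by (intro mult_nonneg_nonneg) auto
  then show "0 \<le> element_form P \<rho> h T w b w b" using le X0 by linarith
  assume "element_form P \<rho> h T w b w b = 0"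
  then have "X = 0" "\<rho> / (2 * h) * J = 0" using le X0 \<open>0 \<le> \<rho> / (2 * h) * J\<close> by linarith+
  then have G: "G = 0" and J: "J = 0" using pos r by (auto simp: X_def)
  have J': "\<forall>e\<in>tri_edges T. edge_length e * (Qb e (u a G) - b e)\<^sup>2 = 0"
    using J sum_nonneg_eq_0_iff[OF card_tri_edges(1)[OF simplex] t0] unfolding J_def by simp
  then have "b e = a" if e: "e \<in> tri_edges T" for e
  proof -
    have "edge_length e * (Qb e (u a G) - b e)\<^sup>2 = 0" using J' e by blast
    then have "Qb e (u a G) = b e" using edge_facts(3)[OF e] by simp
    then show ?thesis using edge_facts(6)[OF e, of a] unfolding G by simp
  qed
  then show "\<exists>a. w = u a 0 \<and> (\<forall>e\<in>tri_edges T. b e = a)" using wu G by blast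
qed

text \<open>Without integrability the value of the Bochner integral would be the default 0 and the load would not be linear.  On a
set of finite measure a square integrable function is integrable, by \<open>\<bar>F\<bar> \<le> 1 + F\<^sup>2\<close>.\<close>

lemma load_integrable:
  assumes f: "L2_on (Omega P) f" and iT: "interior T \<subseteq> Omega P" and w: "w \<in> kinks T n d (slope_jump P)"
  shows "set_integrable lebesgue T (\<lambda>x. f x * w x)"
proof -
  obtain a G where wu: "w = u a G" using w by (auto simp: kinks_def)
  define F where "F x = indicator (Omega P) x *\<^sub>R f x" for x
  define W where "W x = a + G \<bullet> x + slope_jump P * (G \<bullet> n) * max 0 (n \<bullet> x - d)" for x
  have Fm: "F \<in> borel_measurable lebesgue"
    using f unfolding L2_on_def set_borel_measurable_def F_def by blast
  have Fsq: "(\<lambda>x. (F x)\<^sup>2) = (\<lambda>x. indicator (Omega P) x *\<^sub>R (f x)\<^sup>2)"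
    by (auto simp: F_def indicator_def)
  have "integrable lebesgue (\<lambda>x. (F x)\<^sup>2)"
    using f unfolding Fsq L2_on_def set_integrable_def by blast
  then have "set_integrable lebesgue UNIV (\<lambda>x. (F x)\<^sup>2)" by (simp add: set_integrable_def)
  then have "set_integrable lebesgue T (\<lambda>x. (F x)\<^sup>2)"
    by (rule set_integrable_subset) (use T_measurable in auto)
  then have F2: "(\<lambda>x. (F x)\<^sup>2) integrable_on T" by (rule set_lebesgue_integral_eq_integral(1))
  have Wc: "continuous_on UNIV W" unfolding W_def by (intro continuous_intros)
  have "compact (W ` T)"
    using continuous_on_subset[OF Wc] triangle_basic(1)[OF simplex] by (intro compact_continuous_image) auto
  then have "bounded (W ` T)" by (rule compact_imp_bounded)
  then obtain K where "\<forall>y\<in>W ` T. norm y \<le> K" unfolding bounded_iff by blast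
  then have K: "\<bar>W x\<bar> \<le> K" if "x \<in> T" for x using that by simp
  have "W \<in> borel_measurable lebesgue"
    using Wc by (intro measurable_completion) (simp add: borel_measurable_continuous_onI)
  then have "(\<lambda>x. F x * W x) \<in> borel_measurable lebesgue" using Fm by (rule borel_measurable_times[rotated])
  then have m: "(\<lambda>x. F x * W x) \<in> borel_measurable (lebesgue_on T)" by (rule measurable_restrict_space1)
  have bd: "norm (F x * W x) \<le> K * (1 + (F x)\<^sup>2)" if x: "x \<in> T" for x
  proof -
    have "\<bar>F x\<bar> \<le> 1 + (F x)\<^sup>2"
    proof -
      have "0 \<le> (\<bar>F x\<bar> - 1)\<^sup>2" by simp
      then have "2 * \<bar>F x\<bar> \<le> 1 + (F x)\<^sup>2" by (simp add: power2_diff)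
      then show ?thesis by linarith
    qed
    then have "\<bar>W x\<bar> * \<bar>F x\<bar> \<le> K * (1 + (F x)\<^sup>2)"
      using K[OF x] by (intro mult_mono) auto
    then show ?thesis by (simp add: abs_mult mult.commute)
  qed
  have one: "(\<lambda>x. 1::real) integrable_on T" by (rule integrable_on_const[OF T_measurable(1)])
  have "(\<lambda>x. K * (1 + (F x)\<^sup>2)) integrable_on T"
    using integrable_on_cmult_left[OF integrable_add[OF one F2], of K] by simp
  then have FW: "(\<lambda>x. F x * W x) absolutely_integrable_on T"
    using bd by (intro measurable_bounded_by_integrable_imp_absolutely_integrable[OF m T_measurable(2)]) auto
  show ?thesis
  proof (rule absolutely_integrable_spike[OF FW negligible_convex_frontier[OF triangle_basic(2)[OF simplex]]])
    fix x assume x: "x \<in> T - frontier T"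
    then have "x \<in> interior T" using closure_subset by (auto simp: frontier_def)
    then have "x \<in> Omega P" using iT by blast
    then show "f x * w x = F x * W x" using x by (simp add: wu kink_def W_def F_def)
  qed
qed

end

section \<open>The global problem\<close>

definition wf_comb :: "weak_fun \<Rightarrow> real \<Rightarrow> weak_fun \<Rightarrow> weak_fun" where
  "wf_comb w t v = ((\<lambda>T x. fst w T x + t * fst v T x), (\<lambda>e. snd w e + t * snd v e))"

definition wf_zero :: weak_fun where
  "wf_zero = ((\<lambda>T x. 0), (\<lambda>e. 0))"

lemma wf_comb_zero: "wf_comb wf_zero (-1) wf_zero = wf_zero"
  by (simp add: wf_comb_def wf_zero_def)

lemma wf_comb_diff_eq_zero: "wf_comb w (-1) v = wf_zero \<Longrightarrow> w = v"
  by (auto simp: wf_comb_def wf_zero_def fun_eq_iff prod_eq_iff)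

lemma Vh_iff:
  "v \<in> Vh P \<T> \<longleftrightarrow> (\<forall>T\<in>\<T>. fst v T \<in> local_space P \<T> T) \<and>
     (\<forall>T. T \<notin> \<T> \<longrightarrow> fst v T = (\<lambda>x. 0)) \<and> (\<forall>e. e \<notin> mesh_edges \<T> \<longrightarrow> snd v e = 0)"
  by (auto simp: Vh_def local_space_def interface_elements_def case_prod_beta)

lemma wf_comb_Vh: "w \<in> Vh P \<T> \<Longrightarrow> v \<in> Vh P \<T> \<Longrightarrow> wf_comb w t v \<in> Vh P \<T>"
  unfolding Vh_iff by (auto simp: wf_comb_def intro: local_space_comb)

lemma wf_comb_Vh0: "w \<in> Vh0 P \<T> \<Longrightarrow> v \<in> Vh0 P \<T> \<Longrightarrow> wf_comb w t v \<in> Vh0 P \<T>"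
  using wf_comb_Vh by (fastforce simp: Vh0_def wf_comb_def)

lemma wf_zero_Vh0: "wf_zero \<in> Vh0 P \<T>"
  by (auto simp: Vh0_def Vh_iff wf_zero_def zero_local_space)

lemma iwg_form_sym: "iwg_form P \<T> \<rho> w v = iwg_form P \<T> \<rho> v w"
  unfolding iwg_form_sum by (intro sum.cong refl element_form_sym)

locale immersed_mesh =
  fixes P :: interface_problem and \<T> :: "plane set set"
  assumes setting: "interface_setting P" and mesh: "triangular_mesh P \<T>"
    and resolved: "interface_resolved P \<T>"
begin

lemma finite_mesh: "finite \<T>" using triangular_meshD(1)[OF mesh] .

lemma interior_subset_Omega: "T \<in> \<T> \<Longrightarrow> interior T \<subseteq> Omega P"
  using mesh_interior_subset[OF mesh] setting by (simp add: interface_setting_def)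

lemma framed:
  assumes "T \<in> \<T>"
  obtains n d where "framed_triangle P T n d" "local_space P \<T> T \<subseteq> kinks T n d (slope_jump P)"
proof -
  obtain n d where nd: "frame P T n d" "local_space P \<T> T \<subseteq> kinks T n d (slope_jump P)"
    using local_space_frame[OF setting mesh resolved assms] by blast
  have "framed_triangle P T n d"
    by unfold_locales
      (use nd(1) triangular_meshD(2)[OF mesh assms] setting in \<open>auto simp: interface_setting_def\<close>)
  then show ?thesis using nd(2) that by blast
qed

lemma iwg_form_comb_left:
  assumes "w \<in> Vh P \<T>" "w' \<in> Vh P \<T>" "v \<in> Vh P \<T>"
  shows "iwg_form P \<T> \<rho> (wf_comb w t w') v = iwg_form P \<T> \<rho> w v + t * iwg_form P \<T> \<rho> w' v"
  unfolding iwg_form_sum sum_distrib_left sum.distrib[symmetric]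
proof (rule sum.cong[OF refl])
  fix T assume T: "T \<in> \<T>"
  obtain n d where nd: "framed_triangle P T n d" "local_space P \<T> T \<subseteq> kinks T n d (slope_jump P)"
    by (rule framed[OF T])
  have "fst w T \<in> local_space P \<T> T" "fst w' T \<in> local_space P \<T> T" "fst v T \<in> local_space P \<T> T"
    using assms T by (auto simp: Vh_iff)
  then have k: "fst w T \<in> kinks T n d (slope_jump P)" "fst w' T \<in> kinks T n d (slope_jump P)"
      "fst v T \<in> kinks T n d (slope_jump P)"
    using nd(2) by auto
  show "element_form P \<rho> (mesh_size \<T>) T (fst (wf_comb w t w') T) (snd (wf_comb w t w')) (fst v T) (snd v) =
    element_form P \<rho> (mesh_size \<T>) T (fst w T) (snd w) (fst v T) (snd v)
    + t * element_form P \<rho> (mesh_size \<T>) T (fst w' T) (snd w') (fst v T) (snd v)"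
    unfolding wf_comb_def fst_conv snd_conv
    by (rule framed_triangle.element_form_add_scaled[OF nd(1) k])
qed

lemma iwg_form_comb_right:
  assumes "w \<in> Vh P \<T>" "w' \<in> Vh P \<T>" "v \<in> Vh P \<T>"
  shows "iwg_form P \<T> \<rho> v (wf_comb w t w') = iwg_form P \<T> \<rho> v w + t * iwg_form P \<T> \<rho> v w'"
  using iwg_form_comb_left[OF assms, of \<rho> t] by (simp add: iwg_form_sym[of P \<T> \<rho> v])

lemma iwg_load_comb:
  assumes f: "L2_on (Omega P) f" and "w \<in> Vh P \<T>" "v \<in> Vh P \<T>"
  shows "iwg_load \<T> f (wf_comb w t v) = iwg_load \<T> f w + t * iwg_load \<T> f v"
  unfolding iwg_load_def sum_distrib_left sum.distrib[symmetric]
proof (rule sum.cong[OF refl])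
  fix T assume T: "T \<in> \<T>"
  obtain n d where nd: "framed_triangle P T n d" "local_space P \<T> T \<subseteq> kinks T n d (slope_jump P)"
    by (rule framed[OF T])
  have "fst w T \<in> local_space P \<T> T" "fst v T \<in> local_space P \<T> T"
    using assms T by (auto simp: Vh_iff)
  then have k: "fst w T \<in> kinks T n d (slope_jump P)" "fst v T \<in> kinks T n d (slope_jump P)"
    using nd(2) by auto
  note int = framed_triangle.load_integrable[OF nd(1) f interior_subset_Omega[OF T]]
  have iv: "set_integrable lebesgue T (\<lambda>x. t * (f x * fst v T x))" using int[OF k(2)] by simp
  have "(LINT x:T|lebesgue. f x * fst (wf_comb w t v) T x) =
      (LINT x:T|lebesgue. f x * fst w T x + t * (f x * fst v T x))"
    by (simp add: wf_comb_def algebra_simps)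
  also have "\<dots> = (LINT x:T|lebesgue. f x * fst w T x) + t * (LINT x:T|lebesgue. f x * fst v T x)"
    using set_integral_add(2)[OF int[OF k(1)] iv] by simp
  finally show "(LINT x:T|lebesgue. f x * fst (wf_comb w t v) T x) =
      (LINT x:T|lebesgue. f x * fst w T x) + t * (LINT x:T|lebesgue. f x * fst v T x)" .
qed

lemma diameter_le_mesh_size: "T \<in> \<T> \<Longrightarrow> diameter T \<le> mesh_size \<T>"
  unfolding mesh_size_def using finite_mesh by simp

text \<open>With enough penalty every element contributes a nonnegative amount, so a vanishing form makes
  the function constant on every element and equal to its edge values; a nonzero constant would
  spread from element to element up to a boundary edge.\<close>

lemma iwg_form_definite:
  assumes \<rho>: "0 < \<rho>"
    and pos: "\<And>T. T \<in> \<T> \<Longrightarrow> 0 < diameter T"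
    and large: "\<And>T. T \<in> \<T> \<Longrightarrow>
      32 * (mesh_size \<T>)\<^sup>2 * (flux_bound P)\<^sup>2 \<le> \<rho> * (energy_bound P * measure lebesgue T)"
    and v: "v \<in> Vh0 P \<T>" and zero: "iwg_form P \<T> \<rho> v v = 0"
  shows "v = wf_zero"
proof -
  have vV: "v \<in> Vh P \<T>" and vb: "\<And>e. e \<in> boundary_edges P \<T> \<Longrightarrow> snd v e = 0"
    using v by (auto simp: Vh0_def)
  define Q where "Q T = element_form P \<rho> (mesh_size \<T>) T (fst v T) (snd v) (fst v T) (snd v)" for T
  have loc: "0 \<le> Q T \<and> (Q T = 0 \<longrightarrow>
      (\<exists>a. (\<forall>x\<in>T. fst v T x = a) \<and> (\<forall>x. x \<notin> T \<longrightarrow> fst v T x = 0) \<and> (\<forall>e\<in>tri_edges T. snd v e = a)))"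
    if T: "T \<in> \<T>" for T
  proof -
    obtain n d where nd: "framed_triangle P T n d" "local_space P \<T> T \<subseteq> kinks T n d (slope_jump P)"
      by (rule framed[OF T])
    have k: "fst v T \<in> kinks T n d (slope_jump P)" using vV T nd(2) by (auto simp: Vh_iff)
    have h: "0 < mesh_size \<T>" "diameter T \<le> mesh_size \<T>"
      using pos[OF T] diameter_le_mesh_size[OF T] by auto
    note nz = framed_triangle.element_form_nonneg_zero[OF nd(1) h \<rho> large[OF T] k, of "snd v"]
    show ?thesis
    proof (intro conjI impI)
      show "0 \<le> Q T" unfolding Q_def by (rule nz(1))
      assume "Q T = 0"
      then obtain a where "fst v T = kink T n d (slope_jump P) a 0" "\<forall>e\<in>tri_edges T. snd v e = a"
        using nz(2) unfolding Q_def by blast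
      then show "\<exists>a. (\<forall>x\<in>T. fst v T x = a) \<and> (\<forall>x. x \<notin> T \<longrightarrow> fst v T x = 0) \<and> (\<forall>e\<in>tri_edges T. snd v e = a)"
        by (auto simp: kink_def)
    qed
  qed
  have "(\<Sum>T\<in>\<T>. Q T) = 0" using zero unfolding iwg_form_sum Q_def .
  then have "\<forall>T\<in>\<T>. Q T = 0" using sum_nonneg_eq_0_iff[OF finite_mesh, of Q] loc by simp
  then have "\<forall>T\<in>\<T>. \<exists>a. (\<forall>x\<in>T. fst v T x = a) \<and> (\<forall>x. x \<notin> T \<longrightarrow> fst v T x = 0) \<and> (\<forall>e\<in>tri_edges T. snd v e = a)"
    using loc by blast
  then obtain a where a: "\<And>T x. T \<in> \<T> \<Longrightarrow> x \<in> T \<Longrightarrow> fst v T x = a T"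
      "\<And>T x. T \<in> \<T> \<Longrightarrow> x \<notin> T \<Longrightarrow> fst v T x = 0"
      "\<And>T e. T \<in> \<T> \<Longrightarrow> e \<in> tri_edges T \<Longrightarrow> snd v e = a T"
    by metis
  have a0: "a T = 0" if T: "T \<in> \<T>" for T
  proof (rule ccontr)
    assume ne: "a T \<noteq> 0"
    define S where "S = {T' \<in> \<T>. a T' = a T}"
    have "\<exists>T'\<in>S. \<exists>e\<in>tri_edges T'. e \<in> boundary_edges P \<T>"
    proof (rule marked_elements_reach_boundary[OF mesh])
      show "open (Omega P)" using setting by (simp add: interface_setting_def)
      show "S \<subseteq> \<T>" "S \<noteq> {}" using T by (auto simp: S_def)
      show "T2 \<in> S" if "T1 \<in> S" "T2 \<in> \<T>" "e \<in> tri_edges T1" "e \<in> tri_edges T2" for T1 T2 e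
        using that a(3)[of T1 e] a(3)[of T2 e] by (auto simp: S_def)
    qed
    then obtain T' e where "T' \<in> \<T>" "a T' = a T" "e \<in> tri_edges T'" "e \<in> boundary_edges P \<T>"
      by (auto simp: S_def)
    then show False using a(3)[of T' e] vb[of e] ne by simp
  qed
  have "fst v T x = 0" for T x
  proof (cases "T \<in> \<T>")
    case True
    then show ?thesis using a(1)[OF True, of x] a(2)[OF True, of x] a0[OF True] by (cases "x \<in> T") auto
  next
    case False
    then show ?thesis using vV by (simp add: Vh_iff)
  qed
  moreover have "snd v e = 0" for e
  proof (cases "e \<in> mesh_edges \<T>")
    case True
    then obtain T where "T \<in> \<T>" "e \<in> tri_edges T" by (auto simp: mesh_edges_def)
    then show ?thesis using a(3)[of T e] a0[of T] by simp
  next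
    case False
    then show ?thesis using vV by (simp add: Vh_iff)
  qed
  ultimately show ?thesis by (auto simp: wf_zero_def prod_eq_iff fun_eq_iff)
qed

text \<open>Edge values and suitable point values on the elements.\<close>

lemma separating_functionals:
  obtains K :: "(weak_fun \<Rightarrow> real) set" where "finite K"
    "\<And>k u t v. k \<in> K \<Longrightarrow> k (wf_comb u t v) = k u + t * k v"
    "\<And>v. v \<in> Vh P \<T> \<Longrightarrow> \<forall>k\<in>K. k v = 0 \<Longrightarrow> v = wf_zero"
proof -
  have "\<exists>X. finite X \<and> (\<forall>w\<in>local_space P \<T> T. (\<forall>x\<in>X. w x = 0) \<longrightarrow> w = (\<lambda>x. 0))" if T: "T \<in> \<T>" for T
  proof -
    obtain n d where nd: "framed_triangle P T n d" "local_space P \<T> T \<subseteq> kinks T n d (slope_jump P)"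
      by (rule framed[OF T])
    obtain X where X: "finite X"
        "\<And>a G. (\<And>x. x \<in> X \<Longrightarrow> kink T n d (slope_jump P) a G x = 0) \<Longrightarrow> kink T n d (slope_jump P) a G = (\<lambda>x. 0)"
      by (rule kink_determined[OF triangle_basic(4)[OF framed_triangle.simplex[OF nd(1)]]
            framed_triangle.norm_n[OF nd(1)] framed_triangle.slope_gt[OF nd(1)], of d]) blast
    have "w = (\<lambda>x. 0)" if w: "w \<in> local_space P \<T> T" "\<forall>x\<in>X. w x = 0" for w
    proof -
      obtain a G where "w = kink T n d (slope_jump P) a G"
        using subsetD[OF nd(2) w(1)] by (auto simp: kinks_def)
      then show ?thesis using X(2)[of a G] w(2) by simp
    qed
    then show ?thesis using X(1) by blast
  qed
  then obtain X where X: "\<And>T. T \<in> \<T> \<Longrightarrow> finite (X T)"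
      "\<And>T w. T \<in> \<T> \<Longrightarrow> w \<in> local_space P \<T> T \<Longrightarrow> \<forall>x\<in>X T. w x = 0 \<Longrightarrow> w = (\<lambda>x. 0)"
    by metis
  define K :: "(weak_fun \<Rightarrow> real) set" where "K = (\<Union>T\<in>\<T>. (\<lambda>x v. fst v T x) ` X T) \<union> (\<lambda>e v. snd v e) ` mesh_edges \<T>"
  have "finite (mesh_edges \<T>)"
    unfolding mesh_edges_def using finite_mesh card_tri_edges(1) triangular_meshD(2)[OF mesh] by auto
  then have "finite K" unfolding K_def using finite_mesh X(1) by auto
  moreover have "k (wf_comb u t v) = k u + t * k v" if "k \<in> K" for k u t v
    using that by (auto simp: K_def wf_comb_def)
  moreover have "v = wf_zero" if v: "v \<in> Vh P \<T>" and z: "\<forall>k\<in>K. k v = 0" for v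
  proof -
    have "fst v T = (\<lambda>x. 0)" for T
    proof (cases "T \<in> \<T>")
      case True
      have "\<forall>x\<in>X T. (\<lambda>v. fst v T x) \<in> K" using True unfolding K_def by blast
      then have "\<forall>x\<in>X T. fst v T x = 0" using z by fast
      then show ?thesis using X(2)[OF True] v True by (auto simp: Vh_iff)
    next
      case False
      then show ?thesis using v by (simp add: Vh_iff)
    qed
    moreover have "snd v e = 0" for e
      using z v by (cases "e \<in> mesh_edges \<T>") (auto simp: K_def Vh_iff)
    ultimately show ?thesis by (auto simp: wf_zero_def prod_eq_iff fun_eq_iff)
  qed
  ultimately show ?thesis using that by blast
qed

text \<open>The boundary values are attained by a weak function \<open>lift\<close> that vanishes on all elements; the rest of the solution
solves a problem on \<^term>\<open>Vh0 P \<T>\<close>.\<close>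

lemma iwg_unique_solution:
  assumes dfn: "\<And>v. v \<in> Vh0 P \<T> \<Longrightarrow> iwg_form P \<T> \<rho> v v = 0 \<Longrightarrow> v = wf_zero"
    and f: "L2_on (Omega P) f"
  shows "\<exists>!u. iwg_solution P \<T> \<rho> f g u"
proof (rule ex_ex1I)
  have sub: "Vh0 P \<T> \<subseteq> Vh P \<T>" by (auto simp: Vh0_def)
  note z0 = wf_zero_Vh0[of P \<T>]
  have zV: "wf_zero \<in> Vh P \<T>" using z0 sub by auto
  define lift :: weak_fun where
    "lift = ((\<lambda>T x. 0), (\<lambda>e. if e \<in> boundary_edges P \<T> then Qb e g else 0))"
  have lift: "lift \<in> Vh P \<T>"
    by (auto simp: lift_def Vh_iff zero_local_space boundary_edges_def)
  define F where "F v = iwg_load \<T> f v - iwg_form P \<T> \<rho> lift v" for v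
  have F: "F (wf_comb u t v) = F u + t * F v" if "u \<in> Vh P \<T>" "v \<in> Vh P \<T>" for u t v
    using iwg_load_comb[OF f that, of t] iwg_form_comb_right[OF that lift, of \<rho> t]
    by (simp add: F_def algebra_simps)
  have Fz: "F wf_zero = 0" using F[OF zV zV, of "-1"] by (simp add: wf_comb_zero)
  have Bz: "iwg_form P \<T> \<rho> w wf_zero = 0" if "w \<in> Vh P \<T>" for w
    using iwg_form_comb_right[OF zV zV that, of \<rho> "-1"] by (simp add: wf_comb_zero)
  obtain K :: "(weak_fun \<Rightarrow> real) set" where K: "finite K"
      "\<And>k u t v. k \<in> K \<Longrightarrow> k (wf_comb u t v) = k u + t * k v"
      "\<And>v. v \<in> Vh P \<T> \<Longrightarrow> \<forall>k\<in>K. k v = 0 \<Longrightarrow> v = wf_zero"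
    by (rule separating_functionals) blast
  have "\<exists>u\<in>Vh0 P \<T>. \<forall>v\<in>Vh0 P \<T>. iwg_form P \<T> \<rho> u v = F v"
  proof (rule galerkin_solvable[where comb = wf_comb and K = K])
    show "(\<forall>w\<in>Vh0 P \<T>. iwg_form P \<T> \<rho> w v = 0) \<and> F v = 0"
      if "v \<in> Vh0 P \<T>" "iwg_form P \<T> \<rho> v v = 0" for v
      using dfn[OF that] Bz Fz sub by blast
    show "(\<forall>w\<in>Vh0 P \<T>. iwg_form P \<T> \<rho> w v = 0) \<and> F v = 0"
      if "v \<in> Vh0 P \<T>" "\<forall>k\<in>K. k v = 0" for v
      using K(3)[OF _ that(2)] that(1) Bz Fz sub by blast
    show "Vh0 P \<T> \<noteq> {}" using z0 by blast
  qed (use sub in \<open>simp_all add: subsetD K(1,2) wf_comb_Vh0 F iwg_form_comb_left iwg_form_comb_right\<close>)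
  then obtain u where u: "u \<in> Vh0 P \<T>" "\<forall>v\<in>Vh0 P \<T>. iwg_form P \<T> \<rho> u v = F v" by blast
  have uV: "u \<in> Vh P \<T>" using u sub by auto
  have "iwg_solution P \<T> \<rho> f g (wf_comb lift 1 u)"
    unfolding iwg_solution_def
  proof (intro conjI ballI)
    show "wf_comb lift 1 u \<in> Vh P \<T>" by (rule wf_comb_Vh[OF lift uV])
    show "snd (wf_comb lift 1 u) e = Qb e g" if "e \<in> boundary_edges P \<T>" for e
      using that u(1) by (simp add: wf_comb_def lift_def Vh0_def)
    show "iwg_form P \<T> \<rho> (wf_comb lift 1 u) v = iwg_load \<T> f v" if v: "v \<in> Vh0 P \<T>" for v
      using iwg_form_comb_left[OF lift uV subsetD[OF sub v], of \<rho> 1] u(2) v by (simp add: F_def)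
  qed
  then show "\<exists>u. iwg_solution P \<T> \<rho> f g u" by blast
  fix u w assume u: "iwg_solution P \<T> \<rho> f g u" and w: "iwg_solution P \<T> \<rho> f g w"
  define v where "v = wf_comb u (-1) w"
  have uV: "u \<in> Vh P \<T>" and wV: "w \<in> Vh P \<T>" using u w by (auto simp: iwg_solution_def)
  have "v \<in> Vh P \<T>" unfolding v_def by (rule wf_comb_Vh[OF uV wV])
  then have v0: "v \<in> Vh0 P \<T>"
    using u w by (auto simp: Vh0_def v_def wf_comb_def iwg_solution_def)
  have "iwg_form P \<T> \<rho> v v = iwg_form P \<T> \<rho> u v - iwg_form P \<T> \<rho> w v"
    unfolding v_def using iwg_form_comb_left[OF uV wV wf_comb_Vh[OF uV wV], of \<rho> "-1" "-1"] by simp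
  also have "\<dots> = 0" using u w v0 by (simp add: iwg_solution_def)
  finally have "v = wf_zero" by (rule dfn[OF v0])
  then show "u = w" unfolding v_def by (rule wf_comb_diff_eq_zero)
qed

end

theorem theorem3p1:
  fixes P :: interface_problem and \<kappa> C \<sigma> :: real
  assumes "interface_setting P"
  shows "\<exists>\<rho>0>0. \<forall>\<T> f g \<rho>.
           admissible_mesh P \<kappa> C \<T> \<and>
           (\<forall>T\<in>\<T>. mesh_size \<T> \<le> \<sigma> * diameter T) \<and>
           L2_on (Omega P) f \<and>
           (\<forall>e\<in>boundary_edges P \<T>. L2_edge e g) \<and>
           \<rho> \<ge> \<rho>0 \<longrightarrow>
           (\<exists>!u. iwg_solution P \<T> \<rho> f g u)"
proof -
  define \<epsilon> where "\<epsilon> = energy_bound P"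
  define M where "M = flux_bound P"
  \<comment> \<open>An inscribed disc of radius \<open>r\<close> gives \<open>h \<le> 2 \<sigma> \<kappa> r\<close> and area at least \<open>\<pi> r\<^sup>2\<close>, so the condition
    \<open>32 h\<^sup>2 M\<^sup>2 \<le> \<rho> \<epsilon> \<bar>T\<bar>\<close> of the coercivity estimate follows from \<open>128 \<sigma>\<^sup>2 \<kappa>\<^sup>2 M\<^sup>2 \<le> \<rho> \<epsilon> \<pi>\<close>.\<close>
  define \<rho>0 where "\<rho>0 = 1 + 128 * \<sigma>\<^sup>2 * \<kappa>\<^sup>2 * M\<^sup>2 / (\<epsilon> * pi)"
  have "0 < beta_p P" "0 < beta_m P" using assms by (auto simp: interface_setting_def)
  then have \<epsilon>: "0 < \<epsilon>"
    by (simp add: \<epsilon>_def energy_bound_def beta_min_def slope_jump_def)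
  have \<rho>0: "0 < \<rho>0" unfolding \<rho>0_def using \<epsilon> by (intro add_pos_nonneg) auto
  have main: "\<exists>!u. iwg_solution P \<T> \<rho> f g u"
    if adm: "admissible_mesh P \<kappa> C \<T>" and quasi: "\<forall>T\<in>\<T>. mesh_size \<T> \<le> \<sigma> * diameter T"
      and f: "L2_on (Omega P) f" and \<rho>: "\<rho> \<ge> \<rho>0" for \<T> f g \<rho>
  proof -
    interpret immersed_mesh P \<T>
      by unfold_locales (use assms adm in \<open>auto simp: admissible_mesh_def\<close>)
    have elem: "0 < diameter T \<and> 32 * (mesh_size \<T>)\<^sup>2 * M\<^sup>2 \<le> \<rho> * (\<epsilon> * measure lebesgue T)"
      if T: "T \<in> \<T>" for T
    proof -
      obtain x r where xr: "0 < r" "cball x r \<subseteq> T" "diameter T \<le> \<kappa> * (2 * r)"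
        using adm T by (auto simp: admissible_mesh_def shape_regular_def)
      have Tc: "compact T" using triangle_basic(1)[OF triangular_meshD(2)[OF mesh T]] .
      have "dist x (x + r *\<^sub>R axis 1 1) \<le> diameter T"
      proof (rule diameter_bounded_bound[OF compact_imp_bounded[OF Tc]])
        show "x \<in> T" "x + r *\<^sub>R axis 1 1 \<in> T"
          using xr by (auto intro!: subsetD[OF xr(2)] simp: dist_norm norm_axis_1)
      qed
      then have pos: "0 < diameter T" using xr(1) by (simp add: dist_norm norm_axis_1)
      have h: "0 < mesh_size \<T>" using pos diameter_le_mesh_size[OF T] by linarith
      have area: "pi * r\<^sup>2 \<le> measure lebesgue T"
      proof -
        have "measure lebesgue (cball x r) \<le> measure lebesgue T"
          using xr(2) lmeasurable_compact[OF Tc] by (intro measure_mono_fmeasurable) auto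
        then show ?thesis using content_cball[of r x] xr(1) by (simp add: unit_ball_vol_2)
      qed
      have "(mesh_size \<T>)\<^sup>2 \<le> (\<sigma> * diameter T)\<^sup>2" using quasi T h by (intro power_mono) auto
      also have "\<dots> \<le> \<sigma>\<^sup>2 * (\<kappa> * (2 * r))\<^sup>2"
        unfolding power_mult_distrib[of \<sigma>] using pos xr(3) by (intro mult_left_mono power_mono) auto
      also have "\<sigma>\<^sup>2 * (\<kappa> * (2 * r))\<^sup>2 = 4 * \<sigma>\<^sup>2 * \<kappa>\<^sup>2 * r\<^sup>2"
        by (simp add: power_mult_distrib)
      finally have h2: "(mesh_size \<T>)\<^sup>2 \<le> 4 * \<sigma>\<^sup>2 * \<kappa>\<^sup>2 * r\<^sup>2" .
      have "128 * \<sigma>\<^sup>2 * \<kappa>\<^sup>2 * M\<^sup>2 / (\<epsilon> * pi) \<le> \<rho>" using \<rho> by (simp add: \<rho>0_def)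
      then have r1: "128 * \<sigma>\<^sup>2 * \<kappa>\<^sup>2 * M\<^sup>2 \<le> \<rho> * (\<epsilon> * pi)" using \<epsilon> by (simp add: pos_divide_le_eq)
      have "32 * (mesh_size \<T>)\<^sup>2 * M\<^sup>2 \<le> 32 * (4 * \<sigma>\<^sup>2 * \<kappa>\<^sup>2 * r\<^sup>2) * M\<^sup>2"
        using h2 by (intro mult_right_mono mult_left_mono) auto
      also have "\<dots> = (128 * \<sigma>\<^sup>2 * \<kappa>\<^sup>2 * M\<^sup>2) * r\<^sup>2" by simp
      also have "\<dots> \<le> (\<rho> * (\<epsilon> * pi)) * r\<^sup>2" using r1 by (intro mult_right_mono) auto
      also have "\<dots> = \<rho> * (\<epsilon> * (pi * r\<^sup>2))" by simp
      also have "\<dots> \<le> \<rho> * (\<epsilon> * measure lebesgue T)"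
        using area \<epsilon> \<rho> \<rho>0 by (intro mult_left_mono) auto
      finally show ?thesis using pos by blast
    qed
    have "v = wf_zero" if "v \<in> Vh0 P \<T>" "iwg_form P \<T> \<rho> v v = 0" for v
      using elem that \<rho> \<rho>0 by (intro iwg_form_definite[of \<rho>]) (auto simp: M_def \<epsilon>_def)
    then show ?thesis by (rule iwg_unique_solution[OF _ f])
  qed
  show ?thesis
    by (intro exI[of _ \<rho>0] conjI \<rho>0 allI impI) (elim conjE, rule main)
qed

end
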